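(* Let $\varphi=(1+\sqrt5)/2$, let $S$ be the one-sided subshift on $\Sigma_+^A=\{\omega\in\{0,1\}^{\mathbb{N}}: (\omega_i,\omega_{i+1})\neq(1,1)\ \forall i\}$ with the Markov measure $\mu_+$ described in the context, let $V_S$ be its Perron-Frobenius operator on $L^2(\Sigma_+^A,\mu_+)$, and let $X$ be the test space defined in the context. For any $f\in X$, $$V_S^kf\to\int_{\Sigma_+^A}f\,d\mu_+\cdot\Phi_{0,+}\quad\text{in }X\text{ as }k\to\infty,$$ where $\Phi_{0,+}\equiv1$.
   Context: $(S\omega)_j=\omega_{j+1}$; cylinder sets are $C[i_1,\dots,i_r]=\{\omega\in\Sigma_+^A:\omega_k=i_k,\ k=1,\dots,r\}$. With $P=(p_{ij})_{i,j=0,1}=\begin{pmatrix}\varphi^{-1}&\varphi^{-2}\\1&0\end{pmatrix}$ and $\pi=(\pi_0,\pi_1)=\frac1{\varphi^2+1}(\varphi^2,1)$, $\mu_+$ is the $S$-invariant measure with $\mu_+(C[i_1,\dots,i_r])=\pi_{i_1}p_{i_1i_2}\cdots p_{i_{r-1}i_r}$. The Koopman operator on $L^2(\Sigma_+^A,\mu_+)$ is $(U_Sf)(\omega)=f(S\omega)$ and $V_S=U_S^*$. Let $h(\omega)=\sum_{k\ge1}\omega_k\varphi^{-k}$; $X_n$ is the finite-dimensional span of $\mathbf1_{C[j]}h^i$ ($j=0,1$, $0\le i\le n$) in $L^2(\Sigma_+^A,\mu_+)$, and $X=\varinjlim X_n$ with the inductive limit topology; $V_S$ maps each $X_n$ into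 itself. *)

theory Defs
  imports "HOL-Probability.Probability"
begin

section \<open>The golden mean subshift and its Markov measure\<close>

definition phi :: real
  where "phi = (1 + sqrt 5) / 2"

text \<open>
  Sequences are indexed from \<open>0\<close>, so the entry \<open>\<omega>\<^sub>k\<close> (\<open>k \<ge> 1\<close>) of the mathematical text is
  \<open>w (k - 1)\<close>, and a cylinder \<open>C[i\<^sub>1, \<dots>, i\<^sub>r]\<close> is given by the list \<open>[i\<^sub>1, \<dots>, i\<^sub>r]\<close>.
\<close>

definition Sigma_plus :: "(nat \<Rightarrow> nat) set"
  where "Sigma_plus = {w. (\<forall>i. w i \<in> {0, 1}) \<and> (\<forall>i. (w i, w (Suc i)) \<noteq> (1, 1))}"

definition shift_map :: "(nat \<Rightarrow> nat) \<Rightarrow> (nat \<Rightarrow> nat)"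
  where "shift_map w = (\<lambda>j. w (Suc j))"

definition cylinder :: "nat list \<Rightarrow> (nat \<Rightarrow> nat) set"
  where "cylinder is = {w \<in> Sigma_plus. \<forall>k < length is. w k = is ! k}"

definition trans_prob :: "nat \<Rightarrow> nat \<Rightarrow> real"
  where "trans_prob i j =
    (if i = 0 then (if j = 0 then inverse phi else inverse (phi\<^sup>2))
     else (if j = 0 then 1 else 0))"

definition init_prob :: "nat \<Rightarrow> real"
  where "init_prob i = (if i = 0 then phi\<^sup>2 else 1) / (phi\<^sup>2 + 1)"

definition word_weight :: "nat list \<Rightarrow> real"
  where "word_weight is =
    init_prob (is ! 0) * (\<Prod>k < length is - 1. trans_prob (is ! k) (is ! Suc k))"

definition words :: "nat list set"
  where "words = {is. is \<noteq> [] \<and> set is \<subseteq> {0, 1}}"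

text \<open>
  \<open>extend_measure\<close> falls back to the null measure if no measure with the prescribed values exists;
  the lemmas \<open>emeasure_mu_plus_cylinder\<close> and \<open>distr_shift\<close> below show that this does not happen
  and that the measure is shift-invariant.
\<close>

definition mu_plus :: "(nat \<Rightarrow> nat) measure"
  where "mu_plus = extend_measure Sigma_plus words cylinder (\<lambda>is. ennreal (word_weight is))"

lemma space_mu_plus [simp]: "space mu_plus = Sigma_plus"
  unfolding mu_plus_def by (rule space_extend_measure) (auto simp: cylinder_def)

lemma sets_mu_plus: "sets mu_plus = sigma_sets Sigma_plus (cylinder ` words)"
  unfolding mu_plus_def by (rule sets_extend_measure) (auto simp: cylinder_def)

lemma phi_gt_1: "phi > 1"
proof -
  have "sqrt 5 > 1" by simp
  thus ?thesis unfolding phi_def by simp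
qed

lemma phi_square: "phi\<^sup>2 = phi + 1"
  unfolding phi_def by (simp add: power2_eq_square field_simps)

lemma trans_prob_0_sum: "inverse phi + inverse (phi\<^sup>2) = 1"
proof -
  have "inverse phi + inverse (phi\<^sup>2) = (phi + 1) / phi\<^sup>2"
    using phi_gt_1 by (simp add: field_simps power2_eq_square)
  thus ?thesis using phi_square phi_gt_1 by simp
qed

text \<open>
  The chain is driven by independent coins: after a \<open>0\<close> the next symbol is the next coin,
  after a \<open>1\<close> it is \<open>0\<close>.
\<close>

fun chain :: "(nat \<Rightarrow> bool) \<Rightarrow> nat \<Rightarrow> nat" where
  "chain b 0 = of_bool (b 0)"
| "chain b (Suc n) = (if chain b n = 0 then of_bool (b (Suc n)) else 0)"

definition coin_prob :: "nat \<Rightarrow> real"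
  where "coin_prob n = (if n = 0 then 1 / (phi\<^sup>2 + 1) else inverse (phi\<^sup>2))"

definition coins :: "(nat \<Rightarrow> bool) measure"
  where "coins = (\<Pi>\<^sub>M n\<in>UNIV. measure_pmf (bernoulli_pmf (coin_prob n)))"

lemma coin_prob_range: "0 \<le> coin_prob n" "coin_prob n \<le> 1"
proof -
  have "phi\<^sup>2 > 1" using phi_gt_1 by (simp add: phi_square)
  thus "0 \<le> coin_prob n" "coin_prob n \<le> 1"
    by (auto simp: coin_prob_def inverse_eq_divide divide_le_eq)
qed

lemma chain_Sigma_plus: "chain b \<in> Sigma_plus"
proof -
  have "chain b n \<in> {0, 1}" for n by (cases n) auto
  thus ?thesis by (auto simp: Sigma_plus_def)
qed

definition coin_box :: "nat list \<Rightarrow> nat \<Rightarrow> bool set" where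
  "coin_box is n = (if n = 0 then {is ! 0 = 1}
     else if is ! (n - 1) = 0 then {is ! n = 1}
     else if is ! n = 0 then UNIV else {})"

lemma chain_eq_iff:
  assumes "set is \<subseteq> {0, 1}"
  shows "n < length is \<Longrightarrow> (\<forall>k\<le>n. chain b k = is ! k) \<longleftrightarrow> (\<forall>k\<le>n. b k \<in> coin_box is k)"
proof (induction n)
  case 0
  hence "is ! 0 \<in> {0, 1}" using assms by (meson nth_mem subsetD)
  thus ?case by (auto simp: coin_box_def)
next
  case (Suc n)
  hence r: "is ! Suc n \<in> {0, 1}" "is ! n \<in> {0, 1}" using assms
    by (meson Suc_lessD nth_mem subsetD)+
  have *: "(\<forall>k\<le>Suc n. Q k) \<longleftrightarrow> (\<forall>k\<le>n. Q k) \<and> Q (Suc n)" for Q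
    by (auto simp: le_Suc_eq)
  have IH: "(\<forall>k\<le>n. chain b k = is ! k) \<longleftrightarrow> (\<forall>k\<le>n. b k \<in> coin_box is k)"
    using Suc by simp
  have "chain b (Suc n) = is ! Suc n \<longleftrightarrow> b (Suc n) \<in> coin_box is (Suc n)"
    if "chain b n = is ! n"
    using r that by (auto simp: coin_box_def)
  thus ?case unfolding * using IH by auto
qed

lemma chain_vimage_cylinder:
  assumes "is \<in> words"
  shows "chain -` cylinder is =
    prod_emb UNIV (\<lambda>n. measure_pmf (bernoulli_pmf (coin_prob n))) {..<length is}
      (Pi\<^sub>E {..<length is} (coin_box is))"
proof -
  from assms obtain m where m: "length is = Suc m"
    by (auto simp: words_def) (metis Suc_pred length_greater_0_conv)
  have "chain b \<in> cylinder is \<longleftrightarrow> (\<forall>k<length is. b k \<in> coin_box is k)" for b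
    using chain_eq_iff[of "is" m b] assms chain_Sigma_plus[of b] m
    by (auto simp: cylinder_def words_def less_Suc_eq_le)
  thus ?thesis by (auto simp: prod_emb_def PiE_iff)
qed

lemma space_coins [simp]: "space coins = UNIV"
  by (auto simp: coins_def space_PiM)

lemma measurable_chain: "chain \<in> measurable coins (sigma Sigma_plus (cylinder ` words))"
proof (rule measurable_measure_of)
  show "cylinder ` words \<subseteq> Pow Sigma_plus" by (auto simp: cylinder_def)
  show "chain \<in> space coins \<rightarrow> Sigma_plus" using chain_Sigma_plus by auto
  fix A assume "A \<in> cylinder ` words"
  then obtain "is" where i: "is \<in> words" "A = cylinder is" by auto
  show "chain -` A \<inter> space coins \<in> sets coins"
    unfolding i(2) chain_vimage_cylinder[OF i(1)] coins_def
    by (rule sets.Int) (auto intro!: sets_PiM_I)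
qed

lemma emeasure_coin_box:
  assumes "is \<in> words" "n < length is"
  shows "emeasure (measure_pmf (bernoulli_pmf (coin_prob n))) (coin_box is n) =
    ennreal (if n = 0 then init_prob (is ! 0) else trans_prob (is ! (n - 1)) (is ! n))"
proof -
  have r: "is ! k \<in> {0, 1}" if "k < length is" for k
    using assms(1) nth_mem[OF that] unfolding words_def by blast
  have "0 < length is" "n - 1 < length is" using assms(2) by auto
  with r assms(2) have r0: "is ! 0 \<in> {0, 1}" "is ! n \<in> {0, 1}" "is ! (n - 1) \<in> {0, 1}"
    by blast+
  have pos: "phi\<^sup>2 + 1 > 0" by (simp add: add_nonneg_pos)
  have e: "1 - 1 / (phi\<^sup>2 + 1) = phi\<^sup>2 / (phi\<^sup>2 + 1)" using pos by (simp add: field_simps)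
  have e': "1 - inverse (phi\<^sup>2) = inverse phi" using trans_prob_0_sum by simp
  have pr: "emeasure (measure_pmf (bernoulli_pmf (coin_prob n))) {c}
     = ennreal (if c then coin_prob n else 1 - coin_prob n)" for c
    using coin_prob_range[of n] by (cases c) (auto simp: emeasure_pmf_single)
  show ?thesis
  proof (cases "n = 0")
    case True
    have box: "coin_box is n = {is ! 0 = 1}" using True by (simp add: coin_box_def)
    have "(if is ! 0 = 1 then coin_prob n else 1 - coin_prob n) = init_prob (is ! 0)"
      using True r0(1) e by (elim insertE) (simp_all only: coin_prob_def init_prob_def, simp_all)
    thus ?thesis unfolding box pr using True by simp
  next
    case False
    have "is ! (n - 1) = 0 \<or> is ! (n - 1) = 1" "is ! n = 0 \<or> is ! n = 1"
      using r0 by simp_all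
    then consider "is ! (n - 1) = 0" "is ! n = 0" | "is ! (n - 1) = 0" "is ! n = 1"
      | "is ! (n - 1) = 1" "is ! n = 0" | "is ! (n - 1) = 1" "is ! n = 1"
      by argo
    thus ?thesis
    proof cases
      case 1
      have box: "coin_box is n = {False}" using 1 False by (simp add: coin_box_def)
      show ?thesis unfolding box pr
        using 1 False e' by (simp add: coin_prob_def trans_prob_def)
    next
      case 2
      have box: "coin_box is n = {True}" using 2 False by (simp add: coin_box_def)
      show ?thesis unfolding box pr
        using 2 False by (simp add: coin_prob_def trans_prob_def)
    next
      case 3
      have "coin_box is n = UNIV" using 3 False by (simp add: coin_box_def)
      thus ?thesis using 3 False measure_pmf.emeasure_space_1 by (simp add: trans_prob_def)
    next
      case 4
      have "coin_box is n = {}" using 4 False by (simp add: coin_box_def)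
      thus ?thesis using 4 False by (simp add: trans_prob_def)
    qed
  qed
qed

lemma prod_shift_words:
  assumes "is \<noteq> []"
  shows "(\<Prod>n<length is. if n = 0 then init_prob (is ! 0) else trans_prob (is ! (n - 1)) (is ! n))
    = word_weight is"
proof -
  from assms obtain m where m: "length is = Suc m"
    by (metis Suc_pred length_greater_0_conv)
  show ?thesis unfolding m word_weight_def prod.lessThan_Suc_shift by simp
qed

lemma emeasure_mu_plus_cylinder:
  assumes "is \<in> words"
  shows "emeasure mu_plus (cylinder is) = ennreal (word_weight is)"
proof (rule emeasure_extend_measure[OF mu_plus_def _ _ _ _ assms])
  let ?D = "distr coins (sigma Sigma_plus (cylinder ` words)) chain"
  have sets_D: "sets ?D = sets mu_plus"
    by (simp add: sets_mu_plus) (subst sets_measure_of, auto simp: cylinder_def)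
  show "positive (sets mu_plus) (emeasure ?D)"
    using emeasure_positive[of ?D] by (simp only: sets_D)
  show "countably_additive (sets mu_plus) (emeasure ?D)"
    using emeasure_countably_additive[of ?D] by (simp only: sets_D)
  show "cylinder ` words \<subseteq> Pow Sigma_plus" by (auto simp: cylinder_def)
  fix w assume w: "w \<in> words"
  interpret product_prob_space "\<lambda>n. measure_pmf (bernoulli_pmf (coin_prob n))" UNIV
    by unfold_locales
  have "emeasure ?D (cylinder w) = emeasure coins (chain -` cylinder w \<inter> space coins)"
    by (rule emeasure_distr[OF measurable_chain])
       (subst sets_measure_of, use w in \<open>auto simp: cylinder_def\<close>)
  also have "\<dots> = (\<Prod>n<length w.
      emeasure (measure_pmf (bernoulli_pmf (coin_prob n))) (coin_box w n))"
    unfolding chain_vimage_cylinder[OF w] space_coins Int_UNIV_right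
    unfolding coins_def by (rule emeasure_PiM_emb) auto
  also have "\<dots> = (\<Prod>n<length w. ennreal (if n = 0 then init_prob (w ! 0)
      else trans_prob (w ! (n - 1)) (w ! n)))"
    by (rule prod.cong) (auto simp: emeasure_coin_box[OF w])
  also have "\<dots> = ennreal (word_weight w)"
    using w phi_gt_1 by (subst prod_ennreal)
      (auto simp: words_def prod_shift_words init_prob_def trans_prob_def)
  finally show "emeasure ?D (cylinder w) = ennreal (word_weight w)" .
qed

lemma sets_cylinder [measurable]: "is \<in> words \<Longrightarrow> cylinder is \<in> sets mu_plus"
  by (auto simp: sets_mu_plus)

lemma Cons_in_words: "is \<in> words \<Longrightarrow> j \<in> {0, 1} \<Longrightarrow> j # is \<in> words"
  by (auto simp: words_def)

lemma shift_Sigma_plus: "w \<in> Sigma_plus \<Longrightarrow> shift_map w \<in> Sigma_plus"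
  by (auto simp: Sigma_plus_def shift_map_def)

lemma shift_vimage_cylinder:
  assumes "is \<in> words"
  shows "shift_map -` cylinder is \<inter> Sigma_plus = cylinder (0 # is) \<union> cylinder (1 # is)"
proof -
  have "w 0 \<in> {0, 1}" if "w \<in> Sigma_plus" for w
    using that by (auto simp: Sigma_plus_def)
  thus ?thesis
    using shift_Sigma_plus
    by (fastforce simp: cylinder_def shift_map_def All_less_Suc2)
qed

lemma measurable_shift_map [measurable]: "shift_map \<in> measurable mu_plus mu_plus"
proof -
  have "shift_map \<in> measurable mu_plus (sigma Sigma_plus (cylinder ` words))"
  proof (rule measurable_measure_of)
    show "cylinder ` words \<subseteq> Pow Sigma_plus" by (auto simp: cylinder_def)
    show "shift_map \<in> space mu_plus \<rightarrow> Sigma_plus" using shift_Sigma_plus by auto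
    fix A assume "A \<in> cylinder ` words"
    then obtain "is" where i: "is \<in> words" "A = cylinder is" by auto
    show "shift_map -` A \<inter> space mu_plus \<in> sets mu_plus"
      unfolding i(2) space_mu_plus shift_vimage_cylinder[OF i(1)]
      using i(1) by (intro sets.Un sets_cylinder Cons_in_words) auto
  qed
  moreover have "sets (sigma Sigma_plus (cylinder ` words)) = sets mu_plus"
    unfolding sets_mu_plus by (rule sets_measure_of) (auto simp: cylinder_def)
  ultimately show ?thesis using measurable_cong_sets by blast
qed

lemma word_weight_nonneg: "word_weight is \<ge> 0"
  using phi_gt_1 unfolding word_weight_def
  by (intro mult_nonneg_nonneg prod_nonneg) (auto simp: init_prob_def trans_prob_def)

lemma word_weight_Cons:
  assumes "is \<in> words"
  shows "word_weight (0 # is) + word_weight (1 # is) = word_weight is"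
proof -
  from assms obtain a v where i: "is = a # v" "a \<in> {0, 1}"
    by (cases "is") (auto simp: words_def)
  have w: "word_weight (j # a # v) =
      init_prob j * trans_prob j a * (\<Prod>k<length v. trans_prob ((a # v) ! k) (v ! k))" for j
    by (simp add: word_weight_def prod.lessThan_Suc_shift del: prod.lessThan_Suc)
  have pos: "phi\<^sup>2 + 1 > 0" by (simp add: add_nonneg_pos)
  have "init_prob 0 * trans_prob 0 a + init_prob 1 * trans_prob 1 a = init_prob a"
  proof (cases "a = 0")
    case True
    have "phi\<^sup>2 * inverse phi = phi" using phi_gt_1 by (simp add: power2_eq_square)
    thus ?thesis using True pos
      by (simp add: init_prob_def trans_prob_def phi_square flip: add_divide_distrib)
  next
    case False
    thus ?thesis using i phi_gt_1 by (simp add: init_prob_def trans_prob_def)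
  qed
  thus ?thesis unfolding i(1) w
    by (simp add: word_weight_def flip: distrib_right)
qed

lemma Int_stable_cylinders: "Int_stable (insert {} (cylinder ` words))"
proof -
  have *: "cylinder u \<inter> cylinder v \<in> insert {} (cylinder ` words)"
    if u: "u \<in> words" and v: "v \<in> words" and le: "length u \<le> length v" for u v
  proof (cases "\<forall>k<length u. u ! k = v ! k")
    case True
    hence "cylinder u \<inter> cylinder v = cylinder v"
      using le by (force simp: cylinder_def)
    thus ?thesis using v by simp
  next
    case False
    then obtain k where "k < length u" "u ! k \<noteq> v ! k" by blast
    hence "cylinder u \<inter> cylinder v = {}" using le by (force simp: cylinder_def)
    thus ?thesis by simp
  qed
  have "cylinder u \<inter> cylinder v \<in> insert {} (cylinder ` words)"
    if "u \<in> words" "v \<in> words" for u v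
    using *[of u v] *[of v u] that by (cases "length u \<le> length v") (auto simp: Int_commute)
  thus ?thesis by (auto simp: Int_stable_def)
qed

lemma emeasure_mu_plus_finite: "emeasure mu_plus A \<noteq> \<infinity>"
proof -
  have S: "Sigma_plus = cylinder [0] \<union> cylinder [1]"
    by (auto simp: cylinder_def) (auto simp: Sigma_plus_def)
  have "emeasure mu_plus A \<le> emeasure mu_plus Sigma_plus"
    by (metis emeasure_space space_mu_plus)
  also have "\<dots> \<le> emeasure mu_plus (cylinder [0]) + emeasure mu_plus (cylinder [1])"
    unfolding S by (rule emeasure_subadditive) (auto simp: words_def)
  also have "\<dots> < \<infinity>" by (simp add: emeasure_mu_plus_cylinder words_def)
  finally show ?thesis by simp
qed

lemma distr_shift: "distr mu_plus mu_plus shift_map = mu_plus"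
proof (rule sym, rule measure_eqI_generator_eq[OF Int_stable_cylinders, of Sigma_plus _ _
    "\<lambda>i. if i = 0 then cylinder [0] else cylinder [1]"])
  show "insert {} (cylinder ` words) \<subseteq> Pow Sigma_plus" by (auto simp: cylinder_def)
  have "sigma_sets Sigma_plus (insert {} (cylinder ` words)) = sigma_sets Sigma_plus (cylinder ` words)"
    by (rule sigma_sets_eqI) (auto intro: sigma_sets.Empty)
  thus "sets mu_plus = sigma_sets Sigma_plus (insert {} (cylinder ` words))"
    "sets (distr mu_plus mu_plus shift_map) = sigma_sets Sigma_plus (insert {} (cylinder ` words))"
    by (simp_all add: sets_mu_plus)
  show "range (\<lambda>i::nat. if i = 0 then cylinder [0] else cylinder [1]) \<subseteq> insert {} (cylinder ` words)"
    by (auto simp: words_def)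
  show "(\<Union>i::nat. if i = 0 then cylinder [0] else cylinder [1]) = Sigma_plus"
    by (auto simp: cylinder_def split: if_splits) (auto simp: Sigma_plus_def)
  show "emeasure mu_plus (if i = 0 then cylinder [0] else cylinder [1]) \<noteq> \<infinity>" for i :: nat
    by (rule emeasure_mu_plus_finite)
  fix A assume "A \<in> insert {} (cylinder ` words)"
  thus "emeasure mu_plus A = emeasure (distr mu_plus mu_plus shift_map) A"
  proof
    assume "A \<in> cylinder ` words"
    then obtain "is" where i: "is \<in> words" "A = cylinder is" by auto
    have w: "0 # is \<in> words" "1 # is \<in> words" using i(1) by (auto intro: Cons_in_words)
    have "emeasure (distr mu_plus mu_plus shift_map) A
        = emeasure mu_plus (cylinder (0 # is) \<union> cylinder (1 # is))"
      using i(1) by (simp add: i(2) emeasure_distr shift_vimage_cylinder)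
    also have "\<dots> = emeasure mu_plus (cylinder (0 # is)) + emeasure mu_plus (cylinder (1 # is))"
      by (rule plus_emeasure[symmetric, OF sets_cylinder[OF w(1)] sets_cylinder[OF w(2)]])
        (auto simp: cylinder_def All_less_Suc2)
    also have "\<dots> = emeasure mu_plus A"
      using i(1) w word_weight_Cons[OF i(1)] word_weight_nonneg
      by (simp add: i(2) emeasure_mu_plus_cylinder flip: ennreal_plus)
    finally show ?thesis by simp
  qed auto
qed

section \<open>The Hilbert space of square-integrable functions\<close>

text \<open>
  Complex scalars; elements are classes of square-integrable functions modulo equality almost
  everywhere.
\<close>

definition square_integrable :: "((nat \<Rightarrow> nat) \<Rightarrow> complex) \<Rightarrow> bool"
  where "square_integrable f \<longleftrightarrow>
    f \<in> borel_measurable mu_plus \<and> integrable mu_plus (\<lambda>w. (cmod (f w))\<^sup>2)"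

definition L2_eq :: "((nat \<Rightarrow> nat) \<Rightarrow> complex) \<Rightarrow> ((nat \<Rightarrow> nat) \<Rightarrow> complex) \<Rightarrow> bool"
  where "L2_eq f g \<longleftrightarrow>
    square_integrable f \<and> square_integrable g \<and> (AE w in mu_plus. f w = g w)"

lemma square_integrable_zero: "square_integrable (\<lambda>_. 0)"
  by (simp add: square_integrable_def)

lemma square_integrable_scale:
  "square_integrable f \<Longrightarrow> square_integrable (\<lambda>w. c * f w)"
  by (auto simp: square_integrable_def norm_mult power_mult_distrib)

lemma square_integrable_add:
  assumes "square_integrable f" "square_integrable g"
  shows "square_integrable (\<lambda>w. f w + g w)"
proof -
  have [measurable]: "f \<in> borel_measurable mu_plus" "g \<in> borel_measurable mu_plus"
    using assms by (auto simp: square_integrable_def)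
  have "integrable mu_plus (\<lambda>w. 2 * (cmod (f w))\<^sup>2 + 2 * (cmod (g w))\<^sup>2)"
    using assms by (auto simp: square_integrable_def)
  hence "integrable mu_plus (\<lambda>w. (cmod (f w + g w))\<^sup>2)"
  proof (rule Bochner_Integration.integrable_bound)
    have "(cmod (f w + g w))\<^sup>2 \<le> 2 * (cmod (f w))\<^sup>2 + 2 * (cmod (g w))\<^sup>2" for w
    proof -
      have "(cmod (f w + g w))\<^sup>2 \<le> (cmod (f w) + cmod (g w))\<^sup>2"
        by (intro power_mono norm_triangle_ineq) auto
      also have "\<dots> \<le> 2 * (cmod (f w))\<^sup>2 + 2 * (cmod (g w))\<^sup>2"
        using sum_squares_bound[of "cmod (f w)" "cmod (g w)"]
        by (simp add: power2_sum)
      finally show ?thesis .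
    qed
    thus "AE w in mu_plus. norm ((cmod (f w + g w))\<^sup>2)
        \<le> norm (2 * (cmod (f w))\<^sup>2 + 2 * (cmod (g w))\<^sup>2)"
      by (auto simp: abs_of_nonneg)
  qed measurable
  thus ?thesis by (auto simp: square_integrable_def)
qed

lemma measurable_cnj [measurable]: "cnj \<in> borel_measurable borel"
  by (intro borel_measurable_continuous_onI continuous_intros)

lemma integrable_mult_cnj:
  assumes "square_integrable f" "square_integrable g"
  shows "integrable mu_plus (\<lambda>w. f w * cnj (g w))"
proof -
  have [measurable]: "f \<in> borel_measurable mu_plus" "g \<in> borel_measurable mu_plus"
    using assms by (auto simp: square_integrable_def)
  have "integrable mu_plus (\<lambda>w. (cmod (f w))\<^sup>2 + (cmod (g w))\<^sup>2)"
    using assms by (auto simp: square_integrable_def)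
  thus ?thesis
  proof (rule Bochner_Integration.integrable_bound)
    have "cmod (f w * cnj (g w)) \<le> (cmod (f w))\<^sup>2 + (cmod (g w))\<^sup>2" for w
    proof -
      have "2 * (cmod (f w) * cmod (g w)) \<le> (cmod (f w))\<^sup>2 + (cmod (g w))\<^sup>2"
        using sum_squares_bound[of "cmod (f w)" "cmod (g w)"] by simp
      moreover have "0 \<le> cmod (f w) * cmod (g w)" by simp
      ultimately show ?thesis unfolding norm_mult complex_mod_cnj by linarith
    qed
    thus "AE w in mu_plus. norm (f w * cnj (g w)) \<le> norm ((cmod (f w))\<^sup>2 + (cmod (g w))\<^sup>2)"
      by (auto simp: abs_of_nonneg)
  qed measurable
qed

quotient_type L2mu = "(nat \<Rightarrow> nat) \<Rightarrow> complex" / partial: L2_eq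
proof (rule part_equivpI)
  show "\<exists>f. L2_eq f f"
    using square_integrable_zero by (auto simp: L2_eq_def)
  show "symp L2_eq" by (auto simp: symp_def L2_eq_def)
  show "transp L2_eq"
  proof (rule transpI)
    fix f g k assume fg: "L2_eq f g" and gk: "L2_eq g k"
    from fg gk have "AE w in mu_plus. f w = g w" "AE w in mu_plus. g w = k w"
      by (simp_all add: L2_eq_def)
    hence "AE w in mu_plus. f w = k w" by eventually_elim simp
    thus "L2_eq f k" using fg gk by (simp add: L2_eq_def)
  qed
qed

instantiation L2mu :: ab_group_add
begin

lift_definition zero_L2mu :: L2mu is "\<lambda>_. 0"
  by (simp add: L2_eq_def square_integrable_zero)

lift_definition plus_L2mu :: "L2mu \<Rightarrow> L2mu \<Rightarrow> L2mu" is "\<lambda>f g w. f w + g w"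
  by (auto simp: L2_eq_def square_integrable_add)

lift_definition uminus_L2mu :: "L2mu \<Rightarrow> L2mu" is "\<lambda>f w. - f w"
  using square_integrable_scale[of _ "-1"] by (auto simp: L2_eq_def)

lift_definition minus_L2mu :: "L2mu \<Rightarrow> L2mu \<Rightarrow> L2mu" is "\<lambda>f g w. f w - g w"
proof -
  fix f f' g g' assume "L2_eq f f'" "L2_eq g g'"
  thus "L2_eq (\<lambda>w. f w - g w) (\<lambda>w. f' w - g' w)"
    using square_integrable_add[of f "\<lambda>w. - 1 * g w"] square_integrable_add[of f' "\<lambda>w. - 1 * g' w"]
      square_integrable_scale[of g "-1"] square_integrable_scale[of g' "-1"]
    by (auto simp: L2_eq_def)
qed

instance
  by standard
    (transfer; auto simp: L2_eq_def square_integrable_zero algebra_simps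
      square_integrable_add square_integrable_scale[of _ "-1", simplified]
      dest: square_integrable_add[OF _ square_integrable_scale[of _ "-1", simplified]])+

end

text \<open>The library has no class of complex vector spaces, so the scalar action is a separate constant.\<close>

lift_definition scaleC :: "complex \<Rightarrow> L2mu \<Rightarrow> L2mu" is "\<lambda>c f w. c * f w"
  by (auto simp: L2_eq_def square_integrable_scale)

lift_definition cinner :: "L2mu \<Rightarrow> L2mu \<Rightarrow> complex"
  is "\<lambda>f g. LINT w|mu_plus. f w * cnj (g w)"
  by (rule integral_cong_AE) (auto simp: L2_eq_def square_integrable_def)

lemma vector_space_scaleC: "vector_space scaleC"
  by standard
    (transfer; auto simp: L2_eq_def square_integrable_add square_integrable_scale algebra_simps)+

interpretation L2: vector_space scaleC
  by (rule vector_space_scaleC)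

lemma cinner_add_left: "cinner (f + g) k = cinner f k + cinner g k"
  by transfer (simp add: L2_eq_def distrib_right integrable_mult_cnj)

lemma cinner_scaleC_left: "cinner (scaleC c f) g = c * cinner f g"
  by transfer (simp add: mult.assoc)

lemma cinner_commute: "cinner f g = cnj (cinner g f)"
  by transfer (simp add: mult.commute flip: Bochner_Integration.integral_cnj)

lemma integral_mult_cnj_self:
  "(LINT w|mu_plus. f w * cnj (f w)) = complex_of_real (LINT w|mu_plus. (cmod (f w))\<^sup>2)"
proof -
  have "f w * cnj (f w) = complex_of_real ((cmod (f w))\<^sup>2)" for w
    by (rule complex_norm_square[symmetric])
  thus ?thesis by (simp only: integral_complex_of_real)
qed

lemma cinner_self: "cinner f f = complex_of_real (Re (cinner f f))" "Re (cinner f f) \<ge> 0"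
  by (transfer, simp only: integral_mult_cnj_self Re_complex_of_real)
    (transfer, simp only: integral_mult_cnj_self Re_complex_of_real, simp)

lemma cinner_self_eq_0_iff: "cinner f f = 0 \<longleftrightarrow> f = 0"
proof transfer
  fix f assume "L2_eq f f"
  hence f: "square_integrable f" by (simp add: L2_eq_def)
  hence "(LINT w|mu_plus. (cmod (f w))\<^sup>2) = 0 \<longleftrightarrow> (AE w in mu_plus. (cmod (f w))\<^sup>2 = 0)"
    by (intro integral_nonneg_eq_0_iff_AE) (auto simp: square_integrable_def)
  thus "(LINT w|mu_plus. f w * cnj (f w)) = 0 \<longleftrightarrow> L2_eq f (\<lambda>_. 0)"
    unfolding integral_mult_cnj_self of_real_eq_0_iff
    using f by (simp add: L2_eq_def square_integrable_zero)
qed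

instantiation L2mu :: real_vector
begin

definition scaleR_L2mu :: "real \<Rightarrow> L2mu \<Rightarrow> L2mu"
  where "scaleR_L2mu r f = scaleC (complex_of_real r) f"

instance
  by standard
    (simp_all add: scaleR_L2mu_def L2.scale_right_distrib L2.scale_left_distrib)

end

instantiation L2mu :: real_inner
begin

definition inner_L2mu :: "L2mu \<Rightarrow> L2mu \<Rightarrow> real"
  where "inner_L2mu f g = Re (cinner f g)"

definition norm_L2mu :: "L2mu \<Rightarrow> real"
  where "norm_L2mu f = sqrt (Re (cinner f f))"

definition sgn_L2mu :: "L2mu \<Rightarrow> L2mu"
  where "sgn_L2mu f = f /\<^sub>R norm f"

definition dist_L2mu :: "L2mu \<Rightarrow> L2mu \<Rightarrow> real"
  where "dist_L2mu f g = norm (f - g)"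

definition uniformity_L2mu :: "(L2mu \<times> L2mu) filter"
  where "uniformity_L2mu = (INF e\<in>{0<..}. principal {(f, g). dist f g < e})"

definition open_L2mu :: "L2mu set \<Rightarrow> bool"
  where "open_L2mu U \<longleftrightarrow> (\<forall>f\<in>U. eventually (\<lambda>(f', g). f' = f \<longrightarrow> g \<in> U) uniformity)"

instance
proof
  fix f g k :: L2mu and r :: real
  show "sgn f = f /\<^sub>R norm f" by (rule sgn_L2mu_def)
  show "dist f g = norm (f - g)" by (rule dist_L2mu_def)
  show "inner f g = inner g f"
    unfolding inner_L2mu_def by (subst cinner_commute) simp
  show "inner (f + g) k = inner f k + inner g k"
    by (simp add: inner_L2mu_def cinner_add_left)
  show "inner (r *\<^sub>R f) g = r * inner f g"
    by (simp add: inner_L2mu_def scaleR_L2mu_def cinner_scaleC_left)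
  show "0 \<le> inner f f" unfolding inner_L2mu_def by (rule cinner_self)
  have "Im (cinner f f) = 0" using arg_cong[OF cinner_self(1)[of f], of Im] by simp
  thus "inner f f = 0 \<longleftrightarrow> f = 0"
    unfolding inner_L2mu_def cinner_self_eq_0_iff[symmetric] by (simp add: complex_eq_iff)
  show "norm f = sqrt (inner f f)"
    by (simp add: norm_L2mu_def inner_L2mu_def)
qed (rule uniformity_L2mu_def, simp add: open_L2mu_def)

end

section \<open>The Koopman and the Perron-Frobenius operator\<close>

definition cadjoint :: "(L2mu \<Rightarrow> L2mu) \<Rightarrow> (L2mu \<Rightarrow> L2mu)"
  where "cadjoint T f = (THE g. \<forall>u. cinner (T u) f = cinner u g)"

lift_definition U_S :: "L2mu \<Rightarrow> L2mu" is "\<lambda>f w. f (shift_map w)"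
proof -
  have si: "square_integrable (\<lambda>w. f (shift_map w))" if "square_integrable f" for f
  proof -
    have [measurable]: "f \<in> borel_measurable mu_plus"
      and i: "integrable mu_plus (\<lambda>w. (cmod (f w))\<^sup>2)"
      using that by (auto simp: square_integrable_def)
    have "integrable (distr mu_plus mu_plus shift_map) (\<lambda>w. (cmod (f w))\<^sup>2)"
      using i by (simp add: distr_shift)
    thus ?thesis by (simp add: square_integrable_def integrable_distr_eq)
  qed
  have ae: "AE w in mu_plus. f (shift_map w) = g (shift_map w)" if "AE w in mu_plus. f w = g w"
    for f g :: "(nat \<Rightarrow> nat) \<Rightarrow> complex"
  proof (rule AE_distrD[OF measurable_shift_map])
    show "AE w in distr mu_plus mu_plus shift_map. f w = g w"
      unfolding distr_shift by (rule that)
  qed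
  show "L2_eq f g \<Longrightarrow> L2_eq (\<lambda>w. f (shift_map w)) (\<lambda>w. g (shift_map w))" for f g
    by (simp add: L2_eq_def si ae)
qed

definition V_S :: "L2mu \<Rightarrow> L2mu"
  where "V_S = cadjoint U_S"

section \<open>The test space\<close>

definition h_phi :: "(nat \<Rightarrow> nat) \<Rightarrow> real"
  where "h_phi w = (\<Sum>k. real (w k) / phi ^ Suc k)"

definition X_fin :: "nat \<Rightarrow> L2mu set"
  where "X_fin n = L2.span
    {abs_L2mu (\<lambda>w. indicator (cylinder [j]) w * complex_of_real (h_phi w ^ i)) | j i.
      j \<in> {0, 1} \<and> i \<le> n}"

definition X_space :: "L2mu set"
  where "X_space = (\<Union>n. X_fin n)"

definition locally_convex_topology :: "L2mu set \<Rightarrow> L2mu topology \<Rightarrow> bool"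
  where "locally_convex_topology V T \<longleftrightarrow>
    topspace T = V \<and>
    continuous_map (prod_topology T T) T (\<lambda>(f, g). f + g) \<and>
    continuous_map (prod_topology euclidean T) T (\<lambda>(c, f). scaleC c f) \<and>
    (\<forall>U. openin T U \<and> 0 \<in> U \<longrightarrow> (\<exists>C\<subseteq>U. convex C \<and> 0 \<in> T interior_of C))"

definition admissible_topology :: "(nat \<Rightarrow> L2mu set) \<Rightarrow> L2mu topology \<Rightarrow> bool"
  where "admissible_topology Y T \<longleftrightarrow>
    locally_convex_topology (\<Union>n. Y n) T \<and>
    (\<forall>n. continuous_map (top_of_set (Y n)) T (\<lambda>f. f))"

text \<open>
  The inductive limit topology is the finest locally convex topology on the union that makes all
  inclusions continuous; it is obtained as the supremum of all such topologies. That this supremum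
  is again locally convex is \<open>inductive_limit_topology_admissible\<close> below.
\<close>

definition inductive_limit_topology :: "(nat \<Rightarrow> L2mu set) \<Rightarrow> L2mu topology"
  where "inductive_limit_topology Y =
    topology_generated_by {U. \<exists>T. admissible_topology Y T \<and> openin T U}"

lemma inductive_limit_topology_finest:
  assumes "admissible_topology Y T" "openin T U"
  shows "openin (inductive_limit_topology Y) U"
  unfolding inductive_limit_topology_def
  by (rule topology_generated_by_Basis) (use assms in blast)

lemma topspace_admissible: "admissible_topology Y T \<Longrightarrow> topspace T = (\<Union>n. Y n)"
  by (simp add: admissible_topology_def locally_convex_topology_def)

lemma continuous_map_indiscrete:
  assumes "f \<in> topspace S \<rightarrow> V"
  shows "continuous_map S (topology_generated_by {V}) f"
proof (rule continuous_on_generated_topo)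
  fix U assume "U \<in> {V}"
  hence "f -` U \<inter> topspace S = topspace S" using assms by auto
  thus "openin S (f -` U \<inter> topspace S)" by simp
qed (use assms in auto)

lemma openin_indiscrete:
  assumes "openin (topology_generated_by {V}) U"
  shows "U = {} \<or> U = V"
proof -
  from assms have "generate_topology_on {V} U"
    by (simp add: openin_topology_generated_by_iff)
  thus ?thesis by induction blast+
qed

lemma indiscrete_admissible:
  assumes "L2.subspace (\<Union>n. Y n)"
  shows "admissible_topology Y (topology_generated_by {\<Union>n. Y n})"
proof -
  define V where "V = (\<Union>n. Y n)"
  have V: "L2.subspace V" using assms by (simp add: V_def)
  have conv: "convex V"
    unfolding convex_def scaleR_L2mu_def
    using V by (auto intro!: L2.subspace_add L2.subspace_scale)
  have "\<exists>C\<subseteq>U. convex C \<and> 0 \<in> topology_generated_by {V} interior_of C"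
    if "openin (topology_generated_by {V}) U" "0 \<in> U" for U
  proof (intro exI[of _ U] conjI)
    show "convex U" using openin_indiscrete[OF that(1)] that(2) conv by auto
    show "0 \<in> topology_generated_by {V} interior_of U"
      using that by (simp add: interior_of_openin)
  qed simp
  moreover have "f \<in> V" if "f \<in> Y n" for f n using that by (auto simp: V_def)
  ultimately show ?thesis
    unfolding admissible_topology_def locally_convex_topology_def V_def[symmetric]
    using V by (auto intro!: continuous_map_indiscrete intro: L2.subspace_add L2.subspace_scale)
qed

lemma continuous_map_inductive_limit:
  assumes "admissible_topology Y T0"
    and cont: "\<And>T. admissible_topology Y T \<Longrightarrow> continuous_map S T f"
  shows "continuous_map S (inductive_limit_topology Y) f"
  unfolding inductive_limit_topology_def
proof (rule continuous_on_generated_topo)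
  fix U assume "U \<in> {U. \<exists>T. admissible_topology Y T \<and> openin T U}"
  then obtain T where T: "admissible_topology Y T" "openin T U" by blast
  have "f -` U \<inter> topspace S = {x \<in> topspace S. f x \<in> U}" by auto
  thus "openin S (f -` U \<inter> topspace S)"
    using cont[OF T(1)] T(2) by (simp add: continuous_map_def)
next
  have "f ` topspace S \<subseteq> topspace T0"
    using cont[OF assms(1)] by (auto simp: continuous_map_def)
  thus "f ` topspace S \<subseteq> \<Union>{U. \<exists>T. admissible_topology Y T \<and> openin T U}"
    using assms(1) openin_topspace[of T0] by blast
qed

lemma continuous_map_finer:
  assumes "continuous_map S T f" "topspace S' = topspace S" "\<And>U. openin S U \<Longrightarrow> openin S' U"
  shows "continuous_map S' T f"
  using assms by (simp add: continuous_map_def)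

lemma openin_prod_topology_mono:
  assumes "\<And>U. openin T U \<Longrightarrow> openin T' U" "\<And>U. openin S U \<Longrightarrow> openin S' U"
    and "openin (prod_topology S T) W"
  shows "openin (prod_topology S' T') W"
  using assms unfolding openin_prod_topology_alt by meson

lemma inductive_limit_topology_admissible:
  assumes "L2.subspace (\<Union>n. Y n)"
  shows "admissible_topology Y (inductive_limit_topology Y)"
proof -
  define L where "L = inductive_limit_topology Y"
  note I = indiscrete_admissible[OF assms]
  have fine: "openin L U" if "admissible_topology Y T" "openin T U" for T U
    unfolding L_def using that by (rule inductive_limit_topology_finest)
  have L_top: "topspace L = (\<Union>n. Y n)"
  proof
    show "topspace L \<subseteq> (\<Union>n. Y n)"
    proof
      fix f assume "f \<in> topspace L"
      then obtain U T where "f \<in> U" and T: "admissible_topology Y T" "openin T U"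
        by (auto simp: L_def inductive_limit_topology_def)
      have "U \<subseteq> (\<Union>n. Y n)"
        using openin_subset[OF T(2)] unfolding topspace_admissible[OF T(1)] .
      with \<open>f \<in> U\<close> show "f \<in> (\<Union>n. Y n)" by (rule subsetD[rotated])
    qed
    show "(\<Union>n. Y n) \<subseteq> topspace L"
      by (intro openin_subset fine[OF I] topology_generated_by_Basis singletonI)
  qed
  have top: "topspace L = topspace T" if "admissible_topology Y T" for T
    unfolding L_top topspace_admissible[OF that] ..
  have add: "continuous_map (prod_topology L L) L (\<lambda>(f, g). f + g)"
    unfolding L_def
  proof (rule continuous_map_inductive_limit[OF I], fold L_def)
    fix T assume T: "admissible_topology Y T"
    hence "continuous_map (prod_topology T T) T (\<lambda>(f, g). f + g)"
      by (simp add: admissible_topology_def locally_convex_topology_def)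
    thus "continuous_map (prod_topology L L) T (\<lambda>(f, g). f + g)"
      by (rule continuous_map_finer)
        (use top[OF T] fine[OF T] in \<open>auto intro: openin_prod_topology_mono\<close>)
  qed
  have scale: "continuous_map (prod_topology euclidean L) L (\<lambda>(c, f). scaleC c f)"
    unfolding L_def
  proof (rule continuous_map_inductive_limit[OF I], fold L_def)
    fix T assume T: "admissible_topology Y T"
    hence "continuous_map (prod_topology euclidean T) T (\<lambda>(c, f). scaleC c f)"
      by (simp add: admissible_topology_def locally_convex_topology_def)
    thus "continuous_map (prod_topology euclidean L) T (\<lambda>(c, f). scaleC c f)"
      by (rule continuous_map_finer)
        (use top[OF T] fine[OF T] in \<open>auto intro: openin_prod_topology_mono\<close>)
  qed
  have incl: "continuous_map (top_of_set (Y n)) L (\<lambda>f. f)" for n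
    unfolding L_def
    by (rule continuous_map_inductive_limit[OF I]) (simp add: admissible_topology_def)
  have "0 \<in> U \<longrightarrow> (\<exists>C\<subseteq>U. convex C \<and> 0 \<in> L interior_of C)" if "openin L U" for U
  proof -
    from that have "generate_topology_on {U. \<exists>T. admissible_topology Y T \<and> openin T U} U"
      by (simp add: L_def inductive_limit_topology_def openin_topology_generated_by_iff)
    thus ?thesis
    proof induction
      case (Int a b)
      show ?case
      proof
        assume "0 \<in> a \<inter> b"
        with Int obtain C D where "C \<subseteq> a" "convex C" "0 \<in> L interior_of C"
          and "D \<subseteq> b" "convex D" "0 \<in> L interior_of D" by auto
        thus "\<exists>C\<subseteq>a \<inter> b. convex C \<and> 0 \<in> L interior_of C"
          by (intro exI[of _ "C \<inter> D"]) (auto simp: interior_of_Int convex_Int)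
      qed
    next
      case (UN K)
      show ?case
      proof
        assume "0 \<in> \<Union>K"
        then obtain k where k: "k \<in> K" "0 \<in> k" by blast
        with UN.IH obtain C where "C \<subseteq> k" "convex C" "0 \<in> L interior_of C" by blast
        with k(1) show "\<exists>C\<subseteq>\<Union>K. convex C \<and> 0 \<in> L interior_of C" by blast
      qed
    next
      case (Basis U)
      then obtain T where T: "admissible_topology Y T" "openin T U" by blast
      have finer: "T interior_of C \<subseteq> L interior_of C" for C
        using fine[OF T(1)] unfolding interior_of_def by blast
      have loc: "\<forall>U. openin T U \<and> 0 \<in> U \<longrightarrow> (\<exists>C\<subseteq>U. convex C \<and> 0 \<in> T interior_of C)"
        using T(1) unfolding admissible_topology_def locally_convex_topology_def by (elim conjE)
      show ?case
      proof
        assume "0 \<in> U"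
        with loc T(2) obtain C where "C \<subseteq> U" "convex C" "0 \<in> T interior_of C" by blast
        with finer[of C] show "\<exists>C\<subseteq>U. convex C \<and> 0 \<in> L interior_of C" by blast
      qed
    qed simp
  qed
  hence local: "\<forall>U. openin L U \<and> 0 \<in> U \<longrightarrow> (\<exists>C\<subseteq>U. convex C \<and> 0 \<in> L interior_of C)"
    by blast
  show ?thesis
    unfolding admissible_topology_def locally_convex_topology_def L_def[symmetric]
    by (intro conjI L_top add scale local allI[OF incl])
qed

definition X_topology :: "L2mu topology"
  where "X_topology = inductive_limit_topology X_fin"

lemma X_fin_mono: "m \<le> n \<Longrightarrow> X_fin m \<subseteq> X_fin n"
  unfolding X_fin_def by (rule L2.span_mono) (blast intro: order_trans)

lemma subspace_X_space: "L2.subspace X_space"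
proof (rule L2.subspaceI)
  have "0 \<in> X_fin 0" unfolding X_fin_def by (rule L2.span_zero)
  thus "0 \<in> X_space" unfolding X_space_def by (rule UN_I[OF UNIV_I])
next
  fix f g assume "f \<in> X_space" "g \<in> X_space"
  then obtain m n where "f \<in> X_fin m" "g \<in> X_fin n" by (auto simp: X_space_def)
  hence "f \<in> X_fin (max m n)" "g \<in> X_fin (max m n)"
    using X_fin_mono[of m "max m n"] X_fin_mono[of n "max m n"] by auto
  hence "f + g \<in> X_fin (max m n)" unfolding X_fin_def by (rule L2.span_add)
  thus "f + g \<in> X_space" unfolding X_space_def by (rule UN_I[OF UNIV_I])
next
  fix c f assume "f \<in> X_space"
  then obtain n where "f \<in> X_fin n" by (auto simp: X_space_def)
  hence "scaleC c f \<in> X_fin n" unfolding X_fin_def by (rule L2.span_scale)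
  thus "scaleC c f \<in> X_space" unfolding X_space_def by (rule UN_I[OF UNIV_I])
qed

lemma admissible_X_topology: "admissible_topology X_fin X_topology"
  unfolding X_topology_def
  by (rule inductive_limit_topology_admissible)
    (rule subspace_X_space[unfolded X_space_def])

definition Phi0 :: L2mu
  where "Phi0 = abs_L2mu (\<lambda>_. 1)"

end

theory Submission
  imports Defs
begin

text \<open>
  Prepending a symbol acts on \<open>h\<close> affinely, \<open>h (j \<omega>) = (j + h \<omega>) / \<phi>\<close>, so \<open>V\<^sub>S\<close> maps
  \<open>\<one>\<^sub>C\<^sub>[\<^sub>j\<^sub>] h\<^sup>i\<close> to \<open>p (\<omega>\<^sub>1, j) ((j + h) / \<phi>)\<^sup>i\<close>. Hence \<open>V\<^sub>S\<close> is block triangular with respect to the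
  degree \<open>i\<close>, with diagonal blocks \<open>\<phi>\<^sup>-\<^sup>i P\<close>. The eigenvalues \<open>\<phi>\<^sup>-\<^sup>i\<close> and \<open>- \<phi>\<^sup>-\<^sup>i\<^sup>-\<^sup>2\<close> of these blocks
  have modulus less than \<open>1\<close>, except for the eigenvalue \<open>1\<close> of the constant function; so every
  mean-zero element of \<open>X\<close> decays under \<open>V\<^sub>S\<close>.
\<close>

section \<open>Coordinates and the function \<open>h_phi\<close>\<close>

lemma phi_pos [simp]: "phi > 0" "phi \<noteq> 0"
  using phi_gt_1 by auto

text \<open>On \<open>Sigma_plus\<close> the first symbol is the indicator of
  \<open>cylinder [1]\<close>, and the symbol at index \<open>k\<close> is the first symbol after
  \<open>k\<close> shifts.\<close>

lemma measurable_coordinate [measurable]: "(\<lambda>w. w k) \<in> measurable mu_plus (count_space UNIV)"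
proof -
  have zero: "(\<lambda>w. w 0) \<in> measurable mu_plus (count_space UNIV)"
  proof (subst measurable_cong)
    show "w 0 = (if w \<in> cylinder [1] then 1 else 0)" if "w \<in> space mu_plus" for w
      using that by (auto simp: cylinder_def Sigma_plus_def)
    have [measurable]: "cylinder [1] \<in> sets mu_plus"
      by (rule sets_cylinder) (simp add: words_def)
    show "(\<lambda>w. if w \<in> cylinder [1] then 1 else 0 :: nat) \<in> measurable mu_plus (count_space UNIV)"
      by measurable
  qed
  have "(shift_map ^^ k) \<in> measurable mu_plus mu_plus"
    by (induction k) (auto intro: measurable_comp[OF _ measurable_shift_map])
  moreover have "(shift_map ^^ k) w i = w (i + k)" for w i
    by (induction k arbitrary: i) (auto simp: shift_map_def)
  ultimately show ?thesis
    using measurable_compose[of "shift_map ^^ k", OF _ zero] by simp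
qed

lemma cylinder_single_eq: "w \<in> cylinder [j] \<longleftrightarrow> w \<in> Sigma_plus \<and> w 0 = j"
  by (auto simp: cylinder_def)

lemma singleton_in_words: "j \<in> {0, 1} \<Longrightarrow> [j] \<in> words"
  by (simp add: words_def)

lemma measurable_h_phi [measurable]: "h_phi \<in> borel_measurable mu_plus"
  unfolding h_phi_def by measurable

lemma summable_inverse_phi: "summable (\<lambda>k. 1 / phi ^ Suc k)"
proof -
  have "summable (\<lambda>k. (1 / phi) * (1 / phi) ^ k)"
    using phi_gt_1 by (intro summable_mult summable_geometric) simp
  thus ?thesis by (simp add: power_one_over)
qed

lemma h_phi_term_le:
  assumes "w \<in> Sigma_plus"
  shows "real (w k) / phi ^ Suc k \<le> 1 / phi ^ Suc k"
proof (rule divide_right_mono)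
  have "w k \<in> {0, 1}" using assms by (auto simp: Sigma_plus_def)
  thus "real (w k) \<le> 1" by auto
qed (simp add: less_imp_le)

lemma summable_h_phi:
  assumes "w \<in> Sigma_plus"
  shows "summable (\<lambda>k. real (w k) / phi ^ Suc k)"
  by (rule summable_comparison_test'[OF summable_inverse_phi])
    (use h_phi_term_le[OF assms] in \<open>simp add: less_imp_le\<close>)

lemma h_phi_bounds:
  assumes "w \<in> Sigma_plus"
  shows "0 \<le> h_phi w" "h_phi w \<le> (\<Sum>k. 1 / phi ^ Suc k)"
  unfolding h_phi_def
  by (rule suminf_nonneg[OF summable_h_phi[OF assms]], simp add: less_imp_le)
    (rule suminf_le[OF h_phi_term_le[OF assms] summable_h_phi[OF assms] summable_inverse_phi])

text \<open>Splitting off the first term of the series leaves the series of the shifted sequence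
  divided by \<open>phi\<close>. Read backwards, this is the affine effect of prepending a
  symbol.\<close>

lemma h_phi_shift:
  assumes "w \<in> Sigma_plus"
  shows "h_phi w = (real (w 0) + h_phi (shift_map w)) / phi"
proof -
  have "h_phi w = real (w 0) / phi + (\<Sum>k. real (w (Suc k)) / phi ^ Suc (Suc k))"
    unfolding h_phi_def using suminf_split_head[OF summable_h_phi[OF assms]] by simp
  also have "(\<Sum>k. real (w (Suc k)) / phi ^ Suc (Suc k))
      = (\<Sum>k. real (shift_map w k) / phi ^ Suc k / phi)"
    by (simp add: shift_map_def mult.commute)
  also have "\<dots> = h_phi (shift_map w) / phi"
    unfolding h_phi_def
    by (rule suminf_divide) (rule summable_h_phi[OF shift_Sigma_plus[OF assms]])
  finally show ?thesis by (simp add: add_divide_distrib)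
qed

section \<open>Reversibility and the change of variables under the shift\<close>

text \<open>The chain is reversible, so the backward transition matrix is again \<open>P\<close>.\<close>

lemma detailed_balance:
  assumes "i \<in> {0, 1}" "j \<in> {0, 1}"
  shows "init_prob i * trans_prob i j = init_prob j * trans_prob j i"
  using assms by (auto simp: init_prob_def trans_prob_def)

text \<open>Detailed balance reverses the new first transition. This restores the initial
  probability of the old first symbol, so the extra factor depends on that symbol alone.\<close>

lemma word_weight_Cons_eq:
  assumes "is \<in> words" "j \<in> {0, 1}"
  shows "word_weight (j # is) = trans_prob (is ! 0) j * word_weight is"
proof -
  from assms obtain a v where i: "is = a # v" "a \<in> {0, 1}"
    by (cases "is") (auto simp: words_def)
  have "word_weight (j # a # v) =
      (init_prob j * trans_prob j a) * (\<Prod>k<length v. trans_prob ((a # v) ! k) (v ! k))"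
    by (simp add: word_weight_def prod.lessThan_Suc_shift del: prod.lessThan_Suc)
  also have "init_prob j * trans_prob j a = init_prob a * trans_prob a j"
    by (rule detailed_balance[OF assms(2) i(2)])
  finally show ?thesis unfolding i(1) by (simp add: word_weight_def)
qed

lemma trans_prob_nonneg: "0 \<le> trans_prob i j"
  by (simp add: trans_prob_def less_imp_le)

text \<open>Cylinders together with the empty set form an intersection-stable generator, and the two
  one-letter cylinders cover the space with finite measure.\<close>

lemma mu_plus_eqI:
  assumes "sets M = sets mu_plus" "sets N = sets mu_plus"
    and fin: "emeasure M Sigma_plus \<noteq> \<infinity>"
    and eq: "\<And>is. is \<in> words \<Longrightarrow> emeasure M (cylinder is) = emeasure N (cylinder is)"
  shows "M = N"
proof (rule measure_eqI_generator_eq[OF Int_stable_cylinders, of Sigma_plus _ _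
    "\<lambda>i. if i = 0 then cylinder [0] else cylinder [1]"])
  show "insert {} (cylinder ` words) \<subseteq> Pow Sigma_plus" by (auto simp: cylinder_def)
  have "sigma_sets Sigma_plus (insert {} (cylinder ` words)) = sigma_sets Sigma_plus (cylinder ` words)"
    by (rule sigma_sets_eqI) (auto intro: sigma_sets.Empty)
  thus "sets M = sigma_sets Sigma_plus (insert {} (cylinder ` words))"
    "sets N = sigma_sets Sigma_plus (insert {} (cylinder ` words))"
    by (simp_all add: assms sets_mu_plus)
  show "range (\<lambda>i::nat. if i = 0 then cylinder [0] else cylinder [1]) \<subseteq> insert {} (cylinder ` words)"
    by (auto simp: words_def)
  show "(\<Union>i::nat. if i = 0 then cylinder [0] else cylinder [1]) = Sigma_plus"
    by (auto simp: cylinder_def split: if_splits) (auto simp: Sigma_plus_def)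
  have "emeasure M A \<le> emeasure M Sigma_plus" for A
    using emeasure_space[of M A] sets_eq_imp_space_eq[OF assms(1)] by simp
  thus "emeasure M (if i = 0 then cylinder [0] else cylinder [1]) \<noteq> \<infinity>" for i :: nat
    using fin by (metis neq_top_trans infinity_ennreal_def)
qed (use eq in auto)

text \<open>The Perron-Frobenius operator at the level of measures. It suffices to compare both
  sides on cylinders, where the density comes from \<open>word_weight_Cons_eq\<close>.\<close>

lemma distr_shift_cylinder:
  assumes j: "j \<in> {0, 1}"
  shows "distr (density mu_plus (indicator (cylinder [j]))) mu_plus shift_map
    = density mu_plus (\<lambda>w. ennreal (trans_prob (w 0) j))" (is "?M = ?N")
proof (rule mu_plus_eqI)
  note [measurable] = sets_cylinder[OF singleton_in_words[OF j]]
  have M: "emeasure ?M A = emeasure mu_plus (cylinder [j] \<inter> (shift_map -` A \<inter> Sigma_plus))"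
    if [measurable]: "A \<in> sets mu_plus" for A
  proof -
    have meas: "shift_map -` A \<inter> Sigma_plus \<in> sets mu_plus"
      using measurable_sets[OF measurable_shift_map that] by simp
    have "emeasure ?M A = (\<integral>\<^sup>+w. indicator (cylinder [j]) w * indicator (shift_map -` A \<inter> Sigma_plus) w \<partial>mu_plus)"
      using meas by (simp add: emeasure_distr emeasure_density)
    also have "\<dots> = emeasure mu_plus (cylinder [j] \<inter> (shift_map -` A \<inter> Sigma_plus))"
      using meas by (simp flip: indicator_inter_arith)
    finally show ?thesis .
  qed
  show "emeasure ?M Sigma_plus \<noteq> \<infinity>"
    using sets.top[of mu_plus] by (simp add: M emeasure_mu_plus_finite del: infinity_ennreal_def)
  fix "is" assume i: "is \<in> words"
  have nz: "is \<noteq> []" using i by (simp add: words_def)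
  \<comment> \<open>Of the two branches of the preimage, only the one that starts with
    \<open>j\<close> meets \<open>cylinder [j]\<close>.\<close>
  have "cylinder [j] \<inter> (cylinder (0 # is) \<union> cylinder (1 # is)) = cylinder (j # is)"
    using j by (auto simp: cylinder_def All_less_Suc2)
  hence "emeasure ?M (cylinder is) = ennreal (word_weight (j # is))"
    using i j by (simp add: M shift_vimage_cylinder emeasure_mu_plus_cylinder Cons_in_words)
  also have "\<dots> = ennreal (trans_prob (is ! 0) j) * emeasure mu_plus (cylinder is)"
    using i j by (simp add: word_weight_Cons_eq ennreal_mult trans_prob_nonneg word_weight_nonneg
        emeasure_mu_plus_cylinder)
  also have "\<dots> = (\<integral>\<^sup>+w. ennreal (trans_prob (is ! 0) j) * indicator (cylinder is) w \<partial>mu_plus)"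
    using i by (simp add: nn_integral_cmult_indicator)
  \<comment> \<open>Inside \<open>cylinder is\<close> the symbol \<open>w 0\<close> is
    \<open>is ! 0\<close>, so the constant can be replaced by the density.\<close>
  also have "\<dots> = (\<integral>\<^sup>+w. ennreal (trans_prob (w 0) j) * indicator (cylinder is) w \<partial>mu_plus)"
    using nz by (intro nn_integral_cong) (auto simp: cylinder_def split: split_indicator)
  also have "\<dots> = emeasure ?N (cylinder is)"
    using i by (simp add: emeasure_density)
  finally show "emeasure ?M (cylinder is) = emeasure ?N (cylinder is)" .
qed simp_all

text \<open>This passes from measures to complex integrals; it removes the shift from the integrand
  in the computation of adjoints.\<close>

lemma integral_shift_cylinder:
  fixes F :: "(nat \<Rightarrow> nat) \<Rightarrow> complex"
  assumes j: "j \<in> {0, 1}" and [measurable]: "F \<in> borel_measurable mu_plus"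
  shows "(LINT w|mu_plus. indicator (cylinder [j]) w * F (shift_map w))
    = (LINT w|mu_plus. complex_of_real (trans_prob (w 0) j) * F w)"
proof -
  note [measurable] = sets_cylinder[OF singleton_in_words[OF j]]
  have "(LINT w|mu_plus. indicator (cylinder [j]) w * F (shift_map w))
      = (LINT w|mu_plus. indicator (cylinder [j]) w *\<^sub>R F (shift_map w))"
    by (intro Bochner_Integration.integral_cong) (auto split: split_indicator)
  also have "\<dots> = (LINT w|density mu_plus (\<lambda>w. ennreal (indicator (cylinder [j]) w)). F (shift_map w))"
    by (rule integral_density[symmetric]) auto
  also have "(\<lambda>w. ennreal (indicator (cylinder [j]) w)) = indicator (cylinder [j])"
    by (auto simp: fun_eq_iff split: split_indicator)
  also have "(LINT w|density mu_plus (indicator (cylinder [j])). F (shift_map w))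
      = (LINT w|distr (density mu_plus (indicator (cylinder [j]))) mu_plus shift_map. F w)"
    by (rule integral_distr[symmetric]) auto
  also have "\<dots> = (LINT w|mu_plus. trans_prob (w 0) j *\<^sub>R F w)"
    unfolding distr_shift_cylinder[OF j]
    by (rule integral_density) (auto simp: trans_prob_nonneg)
  finally show ?thesis by (simp add: scaleR_conv_of_real)
qed

section \<open>Bounded representatives and the norm of \<open>L2mu\<close>\<close>

lemma finite_measure_mu_plus: "finite_measure mu_plus"
  by (rule finite_measureI) (rule emeasure_mu_plus_finite)

lemma square_integrable_bounded:
  assumes [measurable]: "f \<in> borel_measurable mu_plus"
    and "\<And>w. w \<in> Sigma_plus \<Longrightarrow> cmod (f w) \<le> B"
  shows "square_integrable f"
  unfolding square_integrable_def
proof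
  interpret finite_measure mu_plus by (rule finite_measure_mu_plus)
  show "integrable mu_plus (\<lambda>w. (cmod (f w))\<^sup>2)"
    by (rule integrable_const_bound[of _ "B\<^sup>2"])
      (use assms(2) in \<open>auto intro!: AE_I2 power_mono\<close>)
qed fact

lemma L2_eq_rep: "L2_eq (rep_L2mu f) (rep_L2mu f)"
  using Quotient_L2mu by (rule Quotient_rep_reflp)

lemma abs_rep_L2mu: "abs_L2mu (rep_L2mu f) = f"
  using Quotient_L2mu by (rule Quotient_abs_rep)

lemma abs_L2mu_eqI: "L2_eq f g \<Longrightarrow> abs_L2mu f = abs_L2mu g"
  using Quotient_L2mu by (rule Quotient_rel_abs)

lemma L2_eq_self_iff: "L2_eq f f \<longleftrightarrow> square_integrable f"
  by (simp add: L2_eq_def)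

lemma cinner_add_right: "cinner k (f + g) = cinner k f + cinner k g"
  by (metis cinner_add_left cinner_commute complex_cnj_add)

lemma cinner_scaleC_right: "cinner k (scaleC c f) = cnj c * cinner k f"
  by (metis cinner_scaleC_left cinner_commute complex_cnj_mult)

lemma norm_scaleC: "norm (scaleC c f) = cmod c * norm f"
proof -
  have "cinner (scaleC c f) (scaleC c f) = complex_of_real ((cmod c)\<^sup>2) * cinner f f"
    by (simp only: cinner_scaleC_left cinner_scaleC_right complex_norm_square mult_ac)
  thus ?thesis by (simp add: norm_L2mu_def real_sqrt_mult)
qed

lemma tendsto_scaleC: "(g \<longlongrightarrow> l) F \<Longrightarrow> ((\<lambda>x. scaleC c (g x)) \<longlongrightarrow> scaleC c l) F"
proof -
  assume "(g \<longlongrightarrow> l) F"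
  hence "((\<lambda>x. norm (g x - l)) \<longlongrightarrow> 0) F" by (simp add: LIM_zero tendsto_norm_zero)
  hence "((\<lambda>x. norm (scaleC c (g x - l))) \<longlongrightarrow> 0) F"
    unfolding norm_scaleC by (rule tendsto_mult_right_zero)
  hence "((\<lambda>x. scaleC c (g x) - scaleC c l) \<longlongrightarrow> 0) F"
    by (simp add: L2.scale_right_diff_distrib tendsto_norm_zero_iff)
  thus ?thesis by (rule LIM_zero_cancel)
qed

section \<open>Adjoint images under the Koopman operator\<close>

text \<open>
  \<open>cadjoint\<close> is a definite description, so a value of \<open>V_S\<close> is obtained by exhibiting an adjoint
  image; on \<open>X\<close> this can be done explicitly, without the existence of adjoints in general.
\<close>

definition has_adjoint_image :: "L2mu \<Rightarrow> L2mu \<Rightarrow> bool"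
  where "has_adjoint_image f g \<longleftrightarrow> (\<forall>u. cinner (U_S u) f = cinner u g)"

lemma V_S_eq:
  assumes "has_adjoint_image f g"
  shows "V_S f = g"
  unfolding V_S_def cadjoint_def
proof (rule the_equality)
  show "\<forall>u. cinner (U_S u) f = cinner u g" using assms by (simp add: has_adjoint_image_def)
  fix g' assume g': "\<forall>u. cinner (U_S u) f = cinner u g'"
  have "cinner u g' = cinner u g" for u using g' assms by (simp add: has_adjoint_image_def)
  \<comment> \<open>Uniqueness follows by testing both adjoint relations against
    \<open>u = g' - g\<close>.\<close>
  moreover have "cinner (g' - g) g' = cinner (g' - g) g + cinner (g' - g) (g' - g)"
    using cinner_add_right[of "g' - g" g "g' - g"] by simp
  ultimately have "cinner (g' - g) (g' - g) = 0" by simp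
  thus "g' = g" by (simp add: cinner_self_eq_0_iff)
qed

lemma has_adjoint_image_add:
  "has_adjoint_image f g \<Longrightarrow> has_adjoint_image f' g' \<Longrightarrow> has_adjoint_image (f + f') (g + g')"
  by (simp add: has_adjoint_image_def cinner_add_right)

lemma has_adjoint_image_scaleC:
  "has_adjoint_image f g \<Longrightarrow> has_adjoint_image (scaleC c f) (scaleC c g)"
  by (simp add: has_adjoint_image_def cinner_scaleC_right)

lemma has_adjoint_image_zero: "has_adjoint_image 0 0"
  using has_adjoint_image_scaleC[of _ _ 0] cinner_scaleC_right[of _ 0 0]
  by (simp add: has_adjoint_image_def)

section \<open>The action of \<open>V_S\<close> on the spanning functions\<close>

definition basis :: "nat \<Rightarrow> nat \<Rightarrow> L2mu"
  where "basis j i = abs_L2mu (\<lambda>w. indicator (cylinder [j]) w * complex_of_real (h_phi w ^ i))"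

text \<open>An upper bound of \<open>h_phi\<close> on \<open>Sigma_plus\<close>, obtained by
  replacing every digit by 1.\<close>

definition h_bound :: real
  where "h_bound = (\<Sum>k. 1 / phi ^ Suc k)"

lemma square_integrable_basis:
  assumes j: "j \<in> {0, 1}"
  shows "square_integrable (\<lambda>w. indicator (cylinder [j]) w * complex_of_real (h_phi w ^ i))"
proof (rule square_integrable_bounded)
  note [measurable] = sets_cylinder[OF singleton_in_words[OF j]]
  show "(\<lambda>w. indicator (cylinder [j]) w * complex_of_real (h_phi w ^ i)) \<in> borel_measurable mu_plus"
    by measurable
  fix w assume "w \<in> Sigma_plus"
  from h_phi_bounds[OF this]
  show "cmod (indicator (cylinder [j]) w * complex_of_real (h_phi w ^ i)) \<le> h_bound ^ i"
    by (auto simp: norm_mult norm_power h_bound_def split: split_indicator intro!: power_mono)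
qed

text \<open>The function is the candidate for \<open>V_S (basis j i)\<close>; it is bounded because
  \<open>h_phi\<close> is bounded on \<open>Sigma_plus\<close>.\<close>

lemma square_integrable_transfer:
  "square_integrable
    (\<lambda>w. complex_of_real (trans_prob (w 0) j * ((real j + h_phi w) / phi) ^ i))"
proof (rule square_integrable_bounded)
  show "(\<lambda>w. complex_of_real (trans_prob (w 0) j * ((real j + h_phi w) / phi) ^ i))
      \<in> borel_measurable mu_plus"
    by measurable
  fix w assume "w \<in> Sigma_plus"
  from h_phi_bounds[OF this] have "((real j + h_phi w) / phi) ^ i \<le> ((real j + h_bound) / phi) ^ i"
    by (intro power_mono divide_right_mono add_left_mono) (auto simp: h_bound_def less_imp_le)
  moreover have "trans_prob (w 0) j \<le> 1"
    using phi_gt_1 one_less_power[OF phi_gt_1, of 2]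
    by (auto simp: trans_prob_def inverse_le_1_iff not_less less_imp_le)
  ultimately show "cmod (complex_of_real (trans_prob (w 0) j * ((real j + h_phi w) / phi) ^ i))
      \<le> 1 * ((real j + h_bound) / phi) ^ i"
    using h_phi_bounds(1)[OF \<open>w \<in> Sigma_plus\<close>] trans_prob_nonneg
    unfolding norm_of_real abs_mult
    by (intro mult_mono) (auto simp: abs_of_nonneg less_imp_le)
qed

text \<open>On \<open>cylinder [j]\<close> the lemma \<open>h_phi_shift\<close> makes the power of
  \<open>h_phi\<close> a function of \<open>shift_map w\<close>. The whole integrand is then the
  indicator times \<open>F (shift_map w)\<close>, and \<open>integral_shift_cylinder\<close>
  applies. Conjugation acts trivially on the real factor.\<close>

lemma adjoint_basis:
  assumes j: "j \<in> {0, 1}"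
  shows "has_adjoint_image (basis j i)
    (abs_L2mu (\<lambda>w. complex_of_real (trans_prob (w 0) j * ((real j + h_phi w) / phi) ^ i)))"
  unfolding has_adjoint_image_def
proof
  note [measurable] = sets_cylinder[OF singleton_in_words[OF j]]
  fix u
  define v where "v = rep_L2mu u"
  have v: "L2_eq v v" and u: "u = abs_L2mu v"
    by (simp_all add: v_def L2_eq_rep abs_rep_L2mu)
  have [measurable]: "v \<in> borel_measurable mu_plus"
    using v by (simp add: L2_eq_def square_integrable_def)
  have vS: "L2_eq (\<lambda>w. v (shift_map w)) (\<lambda>w. v (shift_map w))"
    using U_S.rsp v by (simp add: rel_fun_def)
  define F where "F w = v w * complex_of_real (((real j + h_phi w) / phi) ^ i)" for w
  have [measurable]: "F \<in> borel_measurable mu_plus" unfolding F_def by measurable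
  have "cinner (U_S u) (basis j i) = (LINT w|mu_plus. v (shift_map w) *
      cnj (indicator (cylinder [j]) w * complex_of_real (h_phi w ^ i)))"
    unfolding u basis_def U_S.abs_eq[OF v]
    by (rule cinner.abs_eq[OF vS]) (simp only: L2_eq_self_iff square_integrable_basis[OF j])
  also have "\<dots> = (LINT w|mu_plus. indicator (cylinder [j]) w * F (shift_map w))"
    by (rule Bochner_Integration.integral_cong)
      (auto simp: F_def cylinder_single_eq h_phi_shift split: split_indicator)
  also have "\<dots> = (LINT w|mu_plus. complex_of_real (trans_prob (w 0) j) * F w)"
    by (rule integral_shift_cylinder[OF j]) measurable
  also have "\<dots> = (LINT w|mu_plus. v w *
      cnj (complex_of_real (trans_prob (w 0) j * ((real j + h_phi w) / phi) ^ i)))"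
    by (rule Bochner_Integration.integral_cong) (simp_all add: F_def)
  also have "\<dots> = cinner u
      (abs_L2mu (\<lambda>w. complex_of_real (trans_prob (w 0) j * ((real j + h_phi w) / phi) ^ i)))"
    unfolding u
    by (rule cinner.abs_eq[OF v, symmetric]) (simp only: L2_eq_self_iff square_integrable_transfer)
  finally show "cinner (U_S u) (basis j i) = \<dots>" .
qed

lemma abs_L2mu_add:
  "square_integrable f \<Longrightarrow> square_integrable g \<Longrightarrow>
    abs_L2mu f + abs_L2mu g = abs_L2mu (\<lambda>w. f w + g w)"
  by (rule plus_L2mu.abs_eq) (simp_all add: L2_eq_self_iff)

lemma abs_L2mu_scaleC:
  "square_integrable f \<Longrightarrow> scaleC c (abs_L2mu f) = abs_L2mu (\<lambda>w. c * f w)"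
  by (rule scaleC.abs_eq) (simp add: L2_eq_self_iff)

lemma square_integrable_sum:
  "(\<And>m. m \<in> A \<Longrightarrow> square_integrable (f m)) \<Longrightarrow> square_integrable (\<lambda>w. \<Sum>m\<in>A. f m w)"
  by (induction A rule: infinite_finite_induct)
    (auto intro: square_integrable_zero square_integrable_add)

lemma abs_L2mu_sum:
  "(\<And>m. m \<in> A \<Longrightarrow> square_integrable (f m)) \<Longrightarrow>
    (\<Sum>m\<in>A. abs_L2mu (f m)) = abs_L2mu (\<lambda>w. \<Sum>m\<in>A. f m w)"
  by (induction A rule: infinite_finite_induct)
    (auto simp: abs_L2mu_add square_integrable_sum zero_L2mu_def)

lemma abs_L2mu_cong:
  assumes "square_integrable f" "square_integrable g" "\<And>w. w \<in> Sigma_plus \<Longrightarrow> f w = g w"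
  shows "abs_L2mu f = abs_L2mu g"
  using assms by (intro abs_L2mu_eqI) (auto simp: L2_eq_def intro!: AE_I2)

text \<open>The transition probabilities into 0 are \<open>inverse phi\<close> from 0 and 1 from 1;
  the factor \<open>inverse phi ^ i\<close> comes from the contraction of
  \<open>h_phi\<close>.\<close>

lemma adjoint_basis_0:
  "has_adjoint_image (basis 0 i)
    (scaleC (complex_of_real (inverse phi ^ i * inverse phi)) (basis 0 i)
      + scaleC (complex_of_real (inverse phi ^ i)) (basis 1 i))"
proof -
  note si = square_integrable_basis square_integrable_scale square_integrable_add
  have "abs_L2mu (\<lambda>w. complex_of_real (trans_prob (w 0) 0 * ((real 0 + h_phi w) / phi) ^ i)) =
    scaleC (complex_of_real (inverse phi ^ i * inverse phi)) (basis 0 i)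
      + scaleC (complex_of_real (inverse phi ^ i)) (basis 1 i)"
    unfolding basis_def
  proof (simp only: abs_L2mu_scaleC abs_L2mu_add si insert_iff simp_thms,
      rule abs_L2mu_cong, goal_cases)
    case (3 w)
    hence "w 0 = 0 \<or> w 0 = 1" by (auto simp: Sigma_plus_def)
    thus ?case using 3
      by (auto simp: trans_prob_def cylinder_single_eq field_simps)
  qed (intro square_integrable_transfer si; simp)+
  thus ?thesis using adjoint_basis[of 0 i] by simp
qed

text \<open>Since 1 never follows 1, only \<open>cylinder [0]\<close> survives. The binomial
  expansion of \<open>(1 + h_phi w) ^ i\<close> yields the lower degrees; its top term
  \<open>m = i\<close> belongs to the diagonal block.\<close>

lemma adjoint_basis_1:
  "has_adjoint_image (basis 1 i)
    (scaleC (complex_of_real (inverse phi ^ i * inverse (phi\<^sup>2)))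
      (\<Sum>m\<le>i. scaleC (of_nat (i choose m)) (basis 0 m)))"
proof -
  note si = square_integrable_basis square_integrable_scale square_integrable_sum
  have "abs_L2mu (\<lambda>w. complex_of_real (trans_prob (w 0) 1 * ((real 1 + h_phi w) / phi) ^ i)) =
    scaleC (complex_of_real (inverse phi ^ i * inverse (phi\<^sup>2)))
      (\<Sum>m\<le>i. scaleC (of_nat (i choose m)) (basis 0 m))"
    unfolding basis_def
  proof (simp only: abs_L2mu_scaleC abs_L2mu_sum si insert_iff simp_thms,
      rule abs_L2mu_cong, goal_cases)
    case (3 w)
    have "(1 + h_phi w) ^ i = (\<Sum>m\<le>i. real (i choose m) * h_phi w ^ m)"
      using binomial_ring[of "h_phi w" 1 i] by (simp add: add.commute)
    hence "complex_of_real ((1 + h_phi w) ^ i)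
        = (\<Sum>m\<le>i. of_nat (i choose m) * complex_of_real (h_phi w ^ m))"
      by simp
    moreover have "w 0 = 0 \<or> w 0 = 1" using 3 by (auto simp: Sigma_plus_def)
    ultimately show ?case using 3
      by (auto simp: trans_prob_def cylinder_single_eq power_divide divide_simps
          simp del: of_real_power of_real_add)
  qed (intro square_integrable_transfer si; simp)+
  thus ?thesis using adjoint_basis[of 1 i] by simp
qed

section \<open>The constant function and the integral\<close>

lemma Phi0_eq: "Phi0 = basis 0 0 + basis 1 0"
proof -
  have "basis 0 0 + basis 1 0 = abs_L2mu (\<lambda>w. indicator (cylinder [0]) w * complex_of_real (h_phi w ^ 0)
      + indicator (cylinder [1]) w * complex_of_real (h_phi w ^ 0))"
    unfolding basis_def by (intro abs_L2mu_add square_integrable_basis) auto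
  also have "\<dots> = Phi0"
    unfolding Phi0_def
  proof (rule abs_L2mu_cong)
    fix w assume w: "w \<in> Sigma_plus"
    hence "w 0 = 0 \<or> w 0 = 1" by (auto simp: Sigma_plus_def)
    thus "indicator (cylinder [0]) w * complex_of_real (h_phi w ^ 0)
      + indicator (cylinder [1]) w * complex_of_real (h_phi w ^ 0) = 1"
      using w by (auto simp: cylinder_single_eq)
  qed (intro square_integrable_basis square_integrable_add square_integrable_bounded[of _ 1]; simp)+
  finally show ?thesis by simp
qed

lemma square_integrable_one: "square_integrable (\<lambda>_. 1)"
  by (rule square_integrable_bounded[of _ 1]) auto

lemma U_S_Phi0: "U_S Phi0 = Phi0"
  unfolding Phi0_def
  by (rule U_S.abs_eq) (simp add: L2_eq_self_iff square_integrable_one)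

text \<open>Writing the integral as an inner product makes it accessible to the adjoint
  relation.\<close>

lemma cinner_Phi0: "cinner f Phi0 = (LINT w|mu_plus. rep_L2mu f w)"
proof -
  have "cinner (abs_L2mu (rep_L2mu f)) (abs_L2mu (\<lambda>_. 1)) = (LINT w|mu_plus. rep_L2mu f w * cnj 1)"
    by (rule cinner.abs_eq[OF L2_eq_rep]) (simp add: L2_eq_self_iff square_integrable_one)
  thus ?thesis by (simp add: abs_rep_L2mu Phi0_def)
qed

lemma cinner_Phi0_Phi0: "cinner Phi0 Phi0 = 1"
proof -
  have S: "Sigma_plus = cylinder [0] \<union> cylinder [1]"
    by (auto simp: cylinder_def) (auto simp: Sigma_plus_def)
  have "emeasure mu_plus Sigma_plus = emeasure mu_plus (cylinder [0]) + emeasure mu_plus (cylinder [1])"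
    unfolding S by (rule plus_emeasure[symmetric])
      (auto simp: cylinder_single_eq intro!: sets_cylinder singleton_in_words)
  also have "\<dots> = ennreal (word_weight [0] + word_weight [1])"
    by (simp add: emeasure_mu_plus_cylinder words_def word_weight_nonneg)
  also have "word_weight [0] + word_weight [1] = 1"
    using add_pos_pos[of "phi\<^sup>2" 1]
    by (simp add: word_weight_def init_prob_def flip: add_divide_distrib)
  finally have "measure mu_plus Sigma_plus = 1" by (simp add: measure_def)
  moreover have "cinner Phi0 Phi0 = (LINT w|mu_plus. 1 * cnj 1)"
    unfolding Phi0_def
    by (rule cinner.abs_eq) (simp_all add: L2_eq_self_iff square_integrable_one)
  ultimately show ?thesis by simp
qed

text \<open>The Koopman operator fixes constants, hence its adjoint preserves the integral.\<close>

lemma adjoint_Phi0: "has_adjoint_image f g \<Longrightarrow> cinner g Phi0 = cinner f Phi0"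
  unfolding has_adjoint_image_def by (metis U_S_Phi0 cinner_commute)

section \<open>Invariance of \<open>X_fin\<close> and linearity of \<open>V_S\<close> on it\<close>

lemma X_fin_eq: "X_fin n = L2.span {basis j i | j i. j \<in> {0, 1} \<and> i \<le> n}"
  by (simp add: X_fin_def basis_def)

lemma subspace_X_fin: "L2.subspace (X_fin n)"
  unfolding X_fin_def by (rule L2.subspace_span)

lemma basis_in_X_fin: "j \<in> {0, 1} \<Longrightarrow> i \<le> n \<Longrightarrow> basis j i \<in> X_fin n"
  unfolding X_fin_eq by (rule L2.span_base) blast

lemmas X_fin_closed =
  L2.subspace_add[OF subspace_X_fin] L2.subspace_scale[OF subspace_X_fin]
  L2.subspace_diff[OF subspace_X_fin] L2.subspace_sum[OF subspace_X_fin]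
  L2.subspace_0[OF subspace_X_fin] basis_in_X_fin

text \<open>The elements with an adjoint image in \<open>X_fin n\<close> form a subspace, and it
  contains the generators because \<open>adjoint_basis_0\<close> and \<open>adjoint_basis_1\<close>
  never raise the degree.\<close>

lemma adjoint_X_fin:
  assumes "f \<in> X_fin n"
  shows "\<exists>g\<in>X_fin n. has_adjoint_image f g"
  using assms unfolding X_fin_eq[of n]
proof (rule L2.span_induct, fold X_fin_eq)
  show "L2.subspace {f. \<exists>g\<in>X_fin n. has_adjoint_image f g}"
    by (rule L2.subspaceI)
      (auto intro: X_fin_closed has_adjoint_image_zero has_adjoint_image_add
        has_adjoint_image_scaleC)
  fix f assume "f \<in> {basis j i | j i. j \<in> {0, 1} \<and> i \<le> n}"
  then obtain j i where f: "f = basis j i" and ji: "j = 0 \<or> j = 1" "i \<le> n" by auto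
  from ji(1) show "\<exists>g\<in>X_fin n. has_adjoint_image f g"
    unfolding f
  proof (elim disjE; hypsubst)
    show "\<exists>g\<in>X_fin n. has_adjoint_image (basis 0 i) g"
      by (rule bexI, rule adjoint_basis_0) (intro X_fin_closed; simp add: ji)
    show "\<exists>g\<in>X_fin n. has_adjoint_image (basis 1 i) g"
      by (rule bexI, rule adjoint_basis_1) (intro X_fin_closed; use ji in simp)
  qed
qed

lemma V_S_X_fin:
  assumes "f \<in> X_fin n"
  shows "has_adjoint_image f (V_S f)" "V_S f \<in> X_fin n"
  using adjoint_X_fin[OF assms] V_S_eq by auto

lemma V_S_add: "f \<in> X_fin n \<Longrightarrow> g \<in> X_fin n \<Longrightarrow> V_S (f + g) = V_S f + V_S g"
  by (intro V_S_eq has_adjoint_image_add V_S_X_fin)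

lemma V_S_scaleC: "f \<in> X_fin n \<Longrightarrow> V_S (scaleC c f) = scaleC c (V_S f)"
  by (intro V_S_eq has_adjoint_image_scaleC V_S_X_fin)

lemma funpow_V_S_X_fin: "f \<in> X_fin n \<Longrightarrow> (V_S ^^ k) f \<in> X_fin n"
  by (induction k) (auto intro: V_S_X_fin)

lemma funpow_V_S_add:
  "f \<in> X_fin n \<Longrightarrow> g \<in> X_fin n \<Longrightarrow> (V_S ^^ k) (f + g) = (V_S ^^ k) f + (V_S ^^ k) g"
  by (induction k) (auto simp: V_S_add[OF funpow_V_S_X_fin funpow_V_S_X_fin])

lemma funpow_V_S_scaleC: "f \<in> X_fin n \<Longrightarrow> (V_S ^^ k) (scaleC c f) = scaleC c ((V_S ^^ k) f)"
  by (induction k) (auto simp: V_S_scaleC[OF funpow_V_S_X_fin])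

section \<open>Convergence to equilibrium in norm\<close>

definition equilibrates :: "L2mu \<Rightarrow> bool"
  where "equilibrates f \<longleftrightarrow> (\<lambda>k. (V_S ^^ k) f) \<longlonglongrightarrow> scaleC (cinner f Phi0) Phi0"

text \<open>The set is cut down to \<open>X_fin n\<close> because additivity and homogeneity of
  \<open>V_S\<close> have been established there.\<close>

lemma subspace_equilibrates: "L2.subspace {f \<in> X_fin n. equilibrates f}"
proof (rule L2.subspaceI)
  show "0 \<in> {f \<in> X_fin n. equilibrates f}"
  proof -
    have 0: "0 \<in> X_fin n" by (rule X_fin_closed)
    have "(V_S ^^ k) 0 = 0" for k using funpow_V_S_scaleC[OF 0, of k 0] by simp
    moreover have "cinner 0 Phi0 = 0" using cinner_scaleC_left[of 0 0 Phi0] by simp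
    ultimately show ?thesis using 0 by (simp add: equilibrates_def)
  qed
  fix f g assume f: "f \<in> {f \<in> X_fin n. equilibrates f}"
  show "scaleC c f \<in> {f \<in> X_fin n. equilibrates f}" for c
    using f tendsto_scaleC[of "\<lambda>k. (V_S ^^ k) f" "scaleC (cinner f Phi0) Phi0" sequentially c]
    by (auto simp: equilibrates_def cinner_scaleC_left funpow_V_S_scaleC intro: X_fin_closed)
  assume g: "g \<in> {f \<in> X_fin n. equilibrates f}"
  show "f + g \<in> {f \<in> X_fin n. equilibrates f}"
    using f g tendsto_add[of "\<lambda>k. (V_S ^^ k) f" _ sequentially "\<lambda>k. (V_S ^^ k) g"]
    by (auto simp: equilibrates_def cinner_add_left funpow_V_S_add L2.scale_left_distrib
        intro: X_fin_closed)
qed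

lemma perturbed_contraction_tendsto_0:
  fixes a b :: "nat \<Rightarrow> real"
  assumes nonneg: "\<And>k. 0 \<le> a k" and step: "\<And>k. a (Suc k) \<le> c * a k + b k"
    and c: "0 \<le> c" "c < 1" and b: "b \<longlonglongrightarrow> 0"
  shows "a \<longlonglongrightarrow> 0"
proof (rule LIMSEQ_I)
  fix e :: real assume e: "e > 0"
  \<comment> \<open>This threshold makes \<open>e / 2\<close> the fixed point of the affine map
    \<open>t\<close> to \<open>c * t + e / 2 * (1 - c)\<close>; from \<open>N\<close> on, the excess
    over it contracts geometrically.\<close>
  hence "e / 2 * (1 - c) > 0" using c by simp
  with b obtain N where N: "\<And>k. k \<ge> N \<Longrightarrow> b k < e / 2 * (1 - c)"
    using order_tendstoD(2)[OF b] unfolding eventually_sequentially by blast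
  have bound: "a (N + k) \<le> c ^ k * a N + e / 2" for k
  proof (induction k)
    case (Suc k)
    have "a (N + Suc k) \<le> c * a (N + k) + e / 2 * (1 - c)"
      using step[of "N + k"] N[of "N + k"] by simp
    also have "\<dots> \<le> c * (c ^ k * a N + e / 2) + e / 2 * (1 - c)"
      using mult_left_mono[OF Suc c(1)] by simp
    finally show ?case by (simp add: field_simps)
  qed (use e in simp)
  have "(\<lambda>k. c ^ k * a N) \<longlonglongrightarrow> 0"
    using c by (intro tendsto_mult_left_zero LIMSEQ_power_zero) simp
  from order_tendstoD(2)[OF this, of "e / 2"] obtain K where
    K: "\<And>k. k \<ge> K \<Longrightarrow> c ^ k * a N < e / 2"
    using e unfolding eventually_sequentially by auto
  show "\<exists>n0. \<forall>n\<ge>n0. norm (a n - 0) < e"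
  proof (intro exI allI impI)
    fix n assume "n \<ge> N + K"
    then obtain k where "n = N + k" "k \<ge> K" using le_Suc_ex[of N n] by auto
    thus "norm (a n - 0) < e" using bound[of k] K[of k] nonneg[of n] by simp
  qed
qed

text \<open>The deviation of the iterates of \<open>x\<close> from equilibrium is contracted by
  \<open>c\<close> at each step, up to the deviation of the iterates of \<open>r\<close>, which
  tends to 0.\<close>

lemma equilibrates_perturbed_eigenvector:
  assumes x: "x \<in> X_fin n" and r: "r \<in> X_fin n" "equilibrates r"
    and V: "V_S x = scaleC c x + r" and c: "cmod c < 1"
  shows "equilibrates x"
proof -
  define y where "y k = (V_S ^^ k) x - scaleC (cinner x Phi0) Phi0" for k
  define z where "z k = (V_S ^^ k) r - scaleC (cinner r Phi0) Phi0" for k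
  have "cinner (V_S x) Phi0 = cinner x Phi0"
    by (rule adjoint_Phi0[OF V_S_X_fin(1)[OF x]])
  \<comment> \<open>Preservation of the integral gives the equilibrium values the same recursion as
    the iterates, so they cancel in \<open>step\<close>.\<close>
  hence m: "cinner x Phi0 = c * cinner x Phi0 + cinner r Phi0"
    unfolding V by (simp add: cinner_add_left cinner_scaleC_left)
  have step: "y (Suc k) = scaleC c (y k) + z k" for k
  proof -
    have "(V_S ^^ Suc k) x = scaleC c ((V_S ^^ k) x) + (V_S ^^ k) r"
      unfolding funpow_Suc_right o_apply V
      using x r by (simp add: funpow_V_S_add[of _ n] funpow_V_S_scaleC[of _ n] X_fin_closed)
    moreover have "scaleC (cinner x Phi0) Phi0
        = scaleC c (scaleC (cinner x Phi0) Phi0) + scaleC (cinner r Phi0) Phi0"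
      by (subst m) (simp add: L2.scale_left_distrib)
    ultimately show ?thesis
      unfolding y_def z_def L2.scale_right_diff_distrib by (metis add_diff_add)
  qed
  have z: "z \<longlonglongrightarrow> 0" using r(2) unfolding z_def equilibrates_def by (rule LIM_zero)
  have "(\<lambda>k. norm (y k)) \<longlonglongrightarrow> 0"
  proof (rule perturbed_contraction_tendsto_0[of _ "cmod c" "\<lambda>k. norm (z k)"])
    show "norm (y (Suc k)) \<le> cmod c * norm (y k) + norm (z k)" for k
      unfolding step norm_scaleC[symmetric] by (rule norm_triangle_ineq)
  qed (use c z in \<open>auto intro: tendsto_norm_zero\<close>)
  hence "y \<longlonglongrightarrow> 0" by (simp add: tendsto_norm_zero_iff)
  thus ?thesis unfolding y_def equilibrates_def by (rule LIM_zero_cancel)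
qed

lemma equilibrates_Phi0: "equilibrates Phi0"
proof -
  have "has_adjoint_image Phi0 Phi0"
  proof -
    have eq: "scaleC (complex_of_real (inverse phi)) (basis 0 0)
        + scaleC (complex_of_real (inverse (phi\<^sup>2))) (basis 0 0) = basis 0 0"
      unfolding L2.scale_left_distrib[symmetric] of_real_add[symmetric] trans_prob_0_sum by simp
    show ?thesis
      using has_adjoint_image_add[OF adjoint_basis_0[of 0] adjoint_basis_1[of 0]] eq
      by (simp add: Phi0_eq add_ac)
  qed
  hence "(V_S ^^ k) Phi0 = Phi0" for k by (induction k) (auto simp: V_S_eq)
  thus ?thesis by (simp add: equilibrates_def cinner_Phi0_Phi0)
qed

text \<open>Strong induction on the degree. Modulo a remainder of lower degree, \<open>V_S\<close>
  acts on \<open>basis 0 i\<close> and \<open>basis 1 i\<close> as a 2 by 2 block. Its eigenvectors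
  equilibrate, and they span both basis elements.\<close>

lemma equilibrates_basis:
  assumes "j \<in> {0, 1}"
  shows "equilibrates (basis j i)"
  using assms
proof (induction i arbitrary: j rule: less_induct)
  case (less i)
  let ?E = "{f \<in> X_fin i. equilibrates f}"
  note E = subspace_equilibrates[of i]
  define l where "l = inverse phi ^ i"
  \<comment> \<open>The lower-degree part of \<open>V_S (basis 1 i)\<close>: the term
    \<open>m = i\<close> is left out, so the induction hypothesis covers every summand.\<close>
  define r where "r = scaleC (complex_of_real (l * inverse (phi\<^sup>2)))
    (\<Sum>m<i. scaleC (of_nat (i choose m)) (basis 0 m))"
  have r: "r \<in> ?E"
    unfolding r_def
    by (intro L2.subspace_scale[OF E] L2.subspace_sum[OF E]) (auto intro: X_fin_closed less.IH)
  have b: "basis 0 i \<in> X_fin i" "basis 1 i \<in> X_fin i" by (auto intro: X_fin_closed)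
  have V0: "V_S (basis 0 i) = scaleC (complex_of_real (l * inverse phi)) (basis 0 i)
      + scaleC (complex_of_real l) (basis 1 i)"
    unfolding l_def by (rule V_S_eq[OF adjoint_basis_0])
  have V1: "V_S (basis 1 i) = scaleC (complex_of_real (l * inverse (phi\<^sup>2))) (basis 0 i) + r"
    unfolding V_S_eq[OF adjoint_basis_1] r_def l_def
    by (simp add: L2.scale_right_distrib add.commute flip: lessThan_Suc_atMost)
  \<comment> \<open>Eigenvectors of the diagonal block of degree \<open>i\<close>, for \<open>\<phi>\<^sup>-\<^sup>i\<close> and \<open>- \<phi>\<^sup>-\<^sup>i\<^sup>-\<^sup>2\<close>\<close>
  define s where "s = basis 0 i + basis 1 i"
  define d where "d = scaleC (complex_of_real (phi\<^sup>2)) (basis 1 i) - basis 0 i"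
  have sX: "s \<in> X_fin i" and dX: "d \<in> X_fin i"
    unfolding s_def d_def by (intro X_fin_closed b)+
  have s: "s \<in> ?E"
  \<comment> \<open>In degree 0 the eigenvalue of \<open>s\<close> is 1 and there is no contraction,
    but then \<open>s\<close> is the fixed vector \<open>Phi0\<close>.\<close>
  proof (cases "i = 0")
    case True
    thus ?thesis using equilibrates_Phi0 sX by (simp add: s_def Phi0_eq)
  next
    case False
    have "V_S s = scaleC (complex_of_real (l * (inverse phi + inverse (phi\<^sup>2)))) (basis 0 i)
        + scaleC (complex_of_real l) (basis 1 i) + r"
      unfolding s_def V_S_add[OF b] V0 V1 distrib_left of_real_add L2.scale_left_distrib
      by (simp only: add_ac)
    hence "V_S s = scaleC (complex_of_real l) s + r"
      unfolding trans_prob_0_sum s_def by (simp add: L2.scale_right_distrib)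
    moreover have "cmod (complex_of_real l) < 1"
      using False phi_gt_1 by (simp add: l_def norm_power norm_inverse power_inverse inverse_less_1_iff)
    ultimately show ?thesis
      using equilibrates_perturbed_eigenvector[OF sX] r sX by blast
  qed
  have d: "d \<in> ?E"
  proof -
    \<comment> \<open>The eigenvalue of \<open>d\<close>: the two facts below match the coefficients
      of \<open>basis 0 i\<close> and \<open>basis 1 i\<close> in \<open>V_S d\<close> with those of
      \<open>scaleC q d\<close>.\<close>
    define q where "q = complex_of_real (- l * inverse (phi\<^sup>2))"
    have q: "complex_of_real (phi\<^sup>2) * complex_of_real (l * inverse (phi\<^sup>2))
        - complex_of_real (l * inverse phi) = - q"
    proof -
      have "phi\<^sup>2 * (l * inverse (phi\<^sup>2)) = l * (inverse phi + inverse (phi\<^sup>2))"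
        unfolding trans_prob_0_sum by simp
      hence "phi\<^sup>2 * (l * inverse (phi\<^sup>2)) - l * inverse phi = l * inverse (phi\<^sup>2)"
        by (simp only: distrib_left)
      thus ?thesis unfolding q_def of_real_mult[symmetric] of_real_diff[symmetric] by simp
    qed
    have q': "q * complex_of_real (phi\<^sup>2) = - complex_of_real l" by (simp add: q_def)
    have "V_S d = V_S (scaleC (complex_of_real (phi\<^sup>2)) (basis 1 i) + scaleC (- 1) (basis 0 i))"
      by (simp add: d_def)
    also have "\<dots> = scaleC (complex_of_real (phi\<^sup>2)) (V_S (basis 1 i)) + scaleC (- 1) (V_S (basis 0 i))"
      unfolding V_S_add[OF X_fin_closed(2)[OF b(2)] X_fin_closed(2)[OF b(1)]]
        V_S_scaleC[OF b(1)] V_S_scaleC[OF b(2)] ..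
    also have "\<dots> = scaleC (complex_of_real (phi\<^sup>2) * complex_of_real (l * inverse (phi\<^sup>2))
          - complex_of_real (l * inverse phi)) (basis 0 i)
        + scaleC (- complex_of_real l) (basis 1 i) + scaleC (complex_of_real (phi\<^sup>2)) r"
      unfolding V0 V1
      by (simp add: L2.scale_right_distrib L2.scale_left_diff_distrib)
    also have "\<dots> = scaleC q d + scaleC (complex_of_real (phi\<^sup>2)) r"
      unfolding q q'[symmetric] d_def by (simp add: L2.scale_right_diff_distrib)
    finally have "V_S d = scaleC q d + scaleC (complex_of_real (phi\<^sup>2)) r" .
    moreover have "cmod q < 1"
    proof -
      have "l \<le> 1" "l > 0" using phi_gt_1 by (auto simp: l_def intro!: power_le_one inverse_le_1_iff[THEN iffD2])
      moreover have "inverse (phi\<^sup>2) < 1" "inverse (phi\<^sup>2) > 0"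
        using one_less_power[OF phi_gt_1, of 2] by (auto simp: inverse_less_1_iff)
      ultimately have "l * inverse (phi\<^sup>2) < 1 * 1" by (intro mult_le_less_imp_less) auto
      thus ?thesis using \<open>l > 0\<close> unfolding q_def norm_of_real by (simp add: abs_mult)
    qed
    ultimately show ?thesis
      using equilibrates_perturbed_eigenvector[OF dX] L2.subspace_scale[OF E r] dX by blast
  qed
  have e1: "basis 1 i \<in> ?E"
  proof -
    have "s + d = scaleC (complex_of_real (1 + phi\<^sup>2)) (basis 1 i)"
      by (simp add: s_def d_def L2.scale_left_distrib)
    moreover have "complex_of_real (1 + phi\<^sup>2) \<noteq> 0"
      unfolding of_real_eq_0_iff using zero_le_power2[of phi] by linarith
    ultimately have "basis 1 i = scaleC (inverse (complex_of_real (1 + phi\<^sup>2))) (s + d)"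
      by simp
    thus ?thesis using L2.subspace_scale[OF E L2.subspace_add[OF E s d]] by simp
  qed
  have "basis 0 i = s - basis 1 i" by (simp add: s_def)
  hence "basis 0 i \<in> ?E" using L2.subspace_diff[OF E s e1] by simp
  with e1 less.prems show ?case by auto
qed

lemma equilibrates_X_fin:
  assumes "f \<in> X_fin n"
  shows "equilibrates f"
proof -
  have "X_fin n \<subseteq> {f \<in> X_fin n. equilibrates f}"
    by (subst X_fin_eq, rule L2.span_minimal[OF _ subspace_equilibrates])
      (auto intro: X_fin_closed equilibrates_basis)
  thus ?thesis using assms by blast
qed

section \<open>Convergence in the inductive limit topology\<close>

text \<open>
  All iterates stay in a single \<open>X_fin n\<close>, on which the inductive limit topology is coarser than the
  norm topology, so convergence in norm is enough.
\<close>

theorem corollary3p20: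
  fixes f :: L2mu
  assumes "f \<in> X_space"
  shows "limitin X_topology (\<lambda>k. (V_S ^^ k) f)
    (scaleC (LINT w|mu_plus. rep_L2mu f w) Phi0) sequentially"
proof -
  from assms obtain n where f: "f \<in> X_fin n" by (auto simp: X_space_def)
  \<comment> \<open>Convergence in the subspace topology requires the limit to lie in
    \<open>X_fin n\<close> as well; constants have degree 0, so any \<open>n\<close> will
    do.\<close>
  have "Phi0 \<in> X_fin n" unfolding Phi0_eq by (intro X_fin_closed; simp)
  hence "limitin (top_of_set (X_fin n)) (\<lambda>k. (V_S ^^ k) f) (scaleC (cinner f Phi0) Phi0) sequentially"
    using equilibrates_X_fin[OF f] funpow_V_S_X_fin[OF f]
    by (simp add: limitin_subtopology equilibrates_def X_fin_closed)
  moreover have "continuous_map (top_of_set (X_fin n)) X_topology (\<lambda>f. f)"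
    using admissible_X_topology by (simp add: admissible_topology_def)
  ultimately have "limitin X_topology (\<lambda>k. (V_S ^^ k) f) (scaleC (cinner f Phi0) Phi0) sequentially"
    using continuous_map_limit by (fastforce simp: o_def)
  thus ?thesis by (simp only: cinner_Phi0)
qed

end
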